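(* Let $\epsilon=\max\{a_1,d-a_{k-1}\}$. Assume that $i,i+1,\dots,i+\epsilon-1\in A_1$ for some $0\le i\le d-\epsilon+1$. Then $K[S]$ is a Cohen--Macaulay ring if and only if the following conditions are satisfied: (i) For all $x\in[0,i-1]\setminus A_1$ we have $x\notin\langle A_1\rangle$ and $x+d\in 2A_1$. (ii) For all $x\in[i+\epsilon,d]\setminus A_1$ we have $d-x\notin\langle A_2\rangle$ and $x\in 2A_1$.
   Context: Let $K$ be a field, $k\ge 3$, and let $0=:a_0<a_1<\cdots<a_k=:d$ be integers with $\gcd(a_1,\dots,a_k)=1$. Put $A_1=\{0,a_1,\dots,a_k\}$ and $A_2=\{d-a_i\mid 0\le i\le k\}$; $\langle A_i\rangle$ is the submonoid of $\mathbb N$ generated by $A_i$, and $2A_1=A_1+A_1=\{a+a'\mid a,a'\in A_1\}$. $[p,q]$ denotes the set of integers $n$ with $p\le n\le q$ (empty if $p>q$). Let $S\subset\mathbb N^2$ be the additive monoid generated by $(a_i,d-a_i)$, $0\le i\le k$, and $K[S]$ its semigroup ring over $K$ (isomorphic to $K[s^{a_i}t^{d-a_i}\mid 0\le i\le k]$). *)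

theory Defs
  imports
    "HOL-Algebra.Ring_Divisibility"
    "HOL-Library.Poly_Mapping"
    "HOL-Library.Product_Plus"
    "HOL-Library.Extended_Nat"
begin

section \<open>Localization\<close>

definition frac_rel :: "('a, 'b) ring_scheme \<Rightarrow> 'a set \<Rightarrow> (('a \<times> 'a) \<times> ('a \<times> 'a)) set" where
  "frac_rel R U = {((r, s), (r', s')).
     r \<in> carrier R \<and> s \<in> U \<and> r' \<in> carrier R \<and> s' \<in> U \<and>
     (\<exists>u\<in>U. u \<otimes>\<^bsub>R\<^esub> (s' \<otimes>\<^bsub>R\<^esub> r) = u \<otimes>\<^bsub>R\<^esub> (s \<otimes>\<^bsub>R\<^esub> r'))}"

definition fraction :: "('a, 'b) ring_scheme \<Rightarrow> 'a set \<Rightarrow> 'a \<Rightarrow> 'a \<Rightarrow> ('a \<times> 'a) set" where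
  "fraction R U r s = frac_rel R U `` {(r, s)}"

text \<open>
  The ring of fractions of \<open>R\<close> with denominators in the multiplicative set \<open>U\<close>. The operations
  are unions over representatives; \<open>localization_mult\<close> and \<open>localization_add\<close> below show that
  they are the usual operations on fractions.
\<close>

definition localization :: "('a, 'b) ring_scheme \<Rightarrow> 'a set \<Rightarrow> (('a \<times> 'a) set) ring" where
  "localization R U =
     \<lparr> carrier = (carrier R \<times> U) // frac_rel R U,
       mult = (\<lambda>X Y. \<Union>(r, s)\<in>X. \<Union>(r', s')\<in>Y. fraction R U (r \<otimes>\<^bsub>R\<^esub> r') (s \<otimes>\<^bsub>R\<^esub> s')),
       one = fraction R U \<one>\<^bsub>R\<^esub> \<one>\<^bsub>R\<^esub>,
       zero = fraction R U \<zero>\<^bsub>R\<^esub> \<one>\<^bsub>R\<^esub>,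
       add = (\<lambda>X Y. \<Union>(r, s)\<in>X. \<Union>(r', s')\<in>Y.
                fraction R U (s' \<otimes>\<^bsub>R\<^esub> r \<oplus>\<^bsub>R\<^esub> s \<otimes>\<^bsub>R\<^esub> r') (s \<otimes>\<^bsub>R\<^esub> s')) \<rparr>"

definition localization_at :: "('a, 'b) ring_scheme \<Rightarrow> 'a set \<Rightarrow> (('a \<times> 'a) set) ring" where
  "localization_at R P = localization R (carrier R - P)"


section \<open>Cohen--Macaulay rings\<close>

definition krull_dim :: "('a, 'b) ring_scheme \<Rightarrow> enat" where
  "krull_dim R = Sup {enat n | n. \<exists>P :: nat \<Rightarrow> 'a set.
     (\<forall>i\<le>n. primeideal (P i) R) \<and> (\<forall>i<n. P i \<subset> P (Suc i))}"

definition regular_sequence :: "('a, 'b) ring_scheme \<Rightarrow> 'a list \<Rightarrow> bool" where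
  "regular_sequence R xs \<longleftrightarrow>
     set xs \<subseteq> carrier R \<and>
     (\<forall>i<length xs. \<forall>y\<in>carrier R.
        xs ! i \<otimes>\<^bsub>R\<^esub> y \<in> genideal R (set (take i xs)) \<longrightarrow> y \<in> genideal R (set (take i xs))) \<and>
     genideal R (set xs) \<noteq> carrier R"

text \<open>
  In a Noetherian local ring with maximal ideal \<open>I\<close> all maximal regular sequences in \<open>I\<close> have
  the same length; the supremum is that length.
\<close>

definition depth :: "('a, 'b) ring_scheme \<Rightarrow> 'a set \<Rightarrow> enat" where
  "depth R I = Sup {enat (length xs) | xs. regular_sequence R xs \<and> set xs \<subseteq> I}"

definition cohen_macaulay_local :: "('a, 'b) ring_scheme \<Rightarrow> bool" where
  "cohen_macaulay_local R \<longleftrightarrow>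
     cring R \<and> noetherian_ring R \<and>
     (\<exists>M. (\<forall>N. maximalideal N R \<longleftrightarrow> N = M) \<and> depth R M = krull_dim R)"

definition cohen_macaulay :: "('a, 'b) ring_scheme \<Rightarrow> bool" where
  "cohen_macaulay R \<longleftrightarrow>
     cring R \<and> noetherian_ring R \<and>
     (\<forall>M. maximalideal M R \<longrightarrow> cohen_macaulay_local (localization_at R M))"


section \<open>Monoids and semigroup rings\<close>

inductive_set monoid_span :: "'a::monoid_add set \<Rightarrow> 'a set" for A where
  zero: "0 \<in> monoid_span A"
| gen: "x \<in> A \<Longrightarrow> x \<in> monoid_span A"
| add: "x \<in> monoid_span A \<Longrightarrow> y \<in> monoid_span A \<Longrightarrow> x + y \<in> monoid_span A"

text \<open>
  The product on \<^typ>\<open>'a \<Rightarrow>\<^sub>0 'k\<close> is convolution, so the finitely supported functions with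
  support in a submonoid \<open>S\<close> form the semigroup ring of \<open>S\<close>.
\<close>

definition semigroup_ring :: "'a::comm_monoid_add set \<Rightarrow> ('a \<Rightarrow>\<^sub>0 'k::field) ring" where
  "semigroup_ring S =
     \<lparr> carrier = {f. Poly_Mapping.keys f \<subseteq> S}, mult = (*), one = 1, zero = 0, add = (+) \<rparr>"


section \<open>Well-definedness\<close>

locale mult_set = cring R for R (structure) +
  fixes U
  assumes U_sub: "U \<subseteq> carrier R"
    and U_one: "\<one> \<in> U"
    and U_mult: "s \<in> U \<Longrightarrow> t \<in> U \<Longrightarrow> s \<otimes> t \<in> U"
begin

lemma U_carrier: "s \<in> U \<Longrightarrow> s \<in> carrier R"
  using U_sub by blast

lemma equiv_frac_rel: "equiv (carrier R \<times> U) (frac_rel R U)"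
proof (rule equivI)
  show "frac_rel R U \<subseteq> (carrier R \<times> U) \<times> (carrier R \<times> U)"
    unfolding frac_rel_def by auto
  show "refl_on (carrier R \<times> U) (frac_rel R U)"
    unfolding refl_on_def frac_rel_def using U_one by auto
  show "sym (frac_rel R U)"
    unfolding sym_def frac_rel_def by (auto, metis)
  show "trans (frac_rel R U)"
  proof (rule transI, clarify)
    fix r s r' s' r'' s''
    assume "((r, s), r', s') \<in> frac_rel R U" "((r', s'), r'', s'') \<in> frac_rel R U"
    then obtain u v where h: "r \<in> carrier R" "s \<in> U" "r' \<in> carrier R" "s' \<in> U" "r'' \<in> carrier R"
      "s'' \<in> U" "u \<in> U" "v \<in> U" "u \<otimes> (s' \<otimes> r) = u \<otimes> (s \<otimes> r')"
      "v \<otimes> (s'' \<otimes> r') = v \<otimes> (s' \<otimes> r'')"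
      unfolding frac_rel_def by auto
    note c = h(1,3,5) h(2,4,6,7,8)[THEN U_carrier]
    have "(u \<otimes> v \<otimes> s') \<otimes> (s'' \<otimes> r) = (v \<otimes> s'') \<otimes> (u \<otimes> (s' \<otimes> r))"
      using c by (simp add: m_ac)
    also have "\<dots> = (u \<otimes> s) \<otimes> (v \<otimes> (s'' \<otimes> r'))"
      using c by (subst h(9)) (simp add: m_ac)
    also have "\<dots> = (u \<otimes> v \<otimes> s') \<otimes> (s \<otimes> r'')"
      using c by (subst h(10)) (simp add: m_ac)
    finally show "((r, s), r'', s'') \<in> frac_rel R U"
      unfolding frac_rel_def using h U_mult by blast
  qed
qed

lemma fraction_eq_iff:
  assumes "r \<in> carrier R" "s \<in> U" "r' \<in> carrier R" "s' \<in> U"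
  shows "fraction R U r s = fraction R U r' s' \<longleftrightarrow> (\<exists>u\<in>U. u \<otimes> (s' \<otimes> r) = u \<otimes> (s \<otimes> r'))"
  using eq_equiv_class_iff[OF equiv_frac_rel, of "(r, s)" "(r', s')"] assms
  unfolding fraction_def by (auto simp: frac_rel_def)

lemma carrier_localization: "carrier (localization R U) = {fraction R U r s | r s. r \<in> carrier R \<and> s \<in> U}"
  unfolding localization_def quotient_def fraction_def by auto

lemma localization_mult:
  assumes "r \<in> carrier R" "s \<in> U" "r' \<in> carrier R" "s' \<in> U"
  shows "fraction R U r s \<otimes>\<^bsub>localization R U\<^esub> fraction R U r' s' = fraction R U (r \<otimes> r') (s \<otimes> s')"
proof -
  let ?f = "\<lambda>x y. case x of (r, s) \<Rightarrow> case y of (r', s') \<Rightarrow> fraction R U (r \<otimes> r') (s \<otimes> s')"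
  have "congruent2 (frac_rel R U) (frac_rel R U) ?f"
  proof (rule congruent2_commuteI[OF equiv_frac_rel])
    show "?f y z = ?f z y" if "y \<in> carrier R \<times> U" "z \<in> carrier R \<times> U" for y z
      using that U_carrier by (auto simp: m_comm)
    show "?f x y = ?f x z" if x: "x \<in> carrier R \<times> U" and yz: "(y, z) \<in> frac_rel R U" for x y z
    proof -
      obtain a b where x': "x = (a, b)" "a \<in> carrier R" "b \<in> U" using x by auto
      obtain r s r' s' u where h: "y = (r, s)" "z = (r', s')" "r \<in> carrier R" "s \<in> U"
        "r' \<in> carrier R" "s' \<in> U" "u \<in> U" "u \<otimes> (s' \<otimes> r) = u \<otimes> (s \<otimes> r')"
        using yz unfolding frac_rel_def by auto
      note c = x'(2) h(3,5) x'(3)[THEN U_carrier] h(4,6,7)[THEN U_carrier]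
      have "u \<otimes> ((b \<otimes> s') \<otimes> (a \<otimes> r)) = (a \<otimes> b) \<otimes> (u \<otimes> (s' \<otimes> r))"
        using c by (simp add: m_ac)
      also have "\<dots> = u \<otimes> ((b \<otimes> s) \<otimes> (a \<otimes> r'))"
        using c by (subst h(8)) (simp add: m_ac)
      finally have "fraction R U (a \<otimes> r) (b \<otimes> s) = fraction R U (a \<otimes> r') (b \<otimes> s')"
        using h x' by (subst fraction_eq_iff) (auto simp: U_mult)
      then show ?thesis using x' h by simp
    qed
  qed
  from UN_equiv_class2[OF equiv_frac_rel equiv_frac_rel this, of "(r, s)" "(r', s')"] assms
  show ?thesis by (simp add: localization_def fraction_def split_def)
qed

lemma localization_add:
  assumes "r \<in> carrier R" "s \<in> U" "r' \<in> carrier R" "s' \<in> U"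
  shows "fraction R U r s \<oplus>\<^bsub>localization R U\<^esub> fraction R U r' s' =
         fraction R U (s' \<otimes> r \<oplus> s \<otimes> r') (s \<otimes> s')"
proof -
  let ?f = "\<lambda>x y. case x of (r, s) \<Rightarrow> case y of (r', s') \<Rightarrow>
     fraction R U (s' \<otimes> r \<oplus> s \<otimes> r') (s \<otimes> s')"
  have "congruent2 (frac_rel R U) (frac_rel R U) ?f"
  proof (rule congruent2_commuteI[OF equiv_frac_rel])
    show "?f y z = ?f z y" if "y \<in> carrier R \<times> U" "z \<in> carrier R \<times> U" for y z
      using that U_carrier by (auto simp: m_comm a_comm)
    show "?f x y = ?f x z" if x: "x \<in> carrier R \<times> U" and yz: "(y, z) \<in> frac_rel R U" for x y z
    proof -
      obtain a b where x': "x = (a, b)" "a \<in> carrier R" "b \<in> U" using x by auto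
      obtain r s r' s' u where h: "y = (r, s)" "z = (r', s')" "r \<in> carrier R" "s \<in> U"
        "r' \<in> carrier R" "s' \<in> U" "u \<in> U" "u \<otimes> (s' \<otimes> r) = u \<otimes> (s \<otimes> r')"
        using yz unfolding frac_rel_def by auto
      note c = x'(2) h(3,5) x'(3)[THEN U_carrier] h(4,6,7)[THEN U_carrier]
      have "u \<otimes> ((b \<otimes> s') \<otimes> (s \<otimes> a \<oplus> b \<otimes> r)) =
            u \<otimes> (b \<otimes> (s \<otimes> (s' \<otimes> a))) \<oplus> (b \<otimes> b) \<otimes> (u \<otimes> (s' \<otimes> r))"
        using c by (simp add: r_distr m_ac)
      also have "\<dots> = u \<otimes> ((b \<otimes> s) \<otimes> (s' \<otimes> a \<oplus> b \<otimes> r'))"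
        using c by (subst h(8)) (simp add: r_distr m_ac)
      finally have "fraction R U (s \<otimes> a \<oplus> b \<otimes> r) (b \<otimes> s) = fraction R U (s' \<otimes> a \<oplus> b \<otimes> r') (b \<otimes> s')"
        using h x' c by (subst fraction_eq_iff) (auto simp: U_mult)
      then show ?thesis using x' h by simp
    qed
  qed
  from UN_equiv_class2[OF equiv_frac_rel equiv_frac_rel this, of "(r, s)" "(r', s')"] assms
  show ?thesis by (simp add: localization_def fraction_def split_def)
qed

lemma fraction_eqI:
  assumes "r \<in> carrier R" "s \<in> U" "r' \<in> carrier R" "s' \<in> U" "s' \<otimes> r = s \<otimes> r'"
  shows "fraction R U r s = fraction R U r' s'"
  using assms U_one by (subst fraction_eq_iff) auto

lemma localization_one: "\<one>\<^bsub>localization R U\<^esub> = fraction R U \<one> \<one>"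
  and localization_zero: "\<zero>\<^bsub>localization R U\<^esub> = fraction R U \<zero> \<one>"
  by (simp_all add: localization_def)

lemma cring_localization: "cring (localization R U)" (is "cring ?L")
proof -
  note loc = localization_mult localization_add localization_one localization_zero
    U_mult U_one U_carrier
  have carrier_iff: "X \<in> carrier ?L \<longleftrightarrow> (\<exists>r s. X = fraction R U r s \<and> r \<in> carrier R \<and> s \<in> U)" for X
    by (auto simp: carrier_localization)
  have assoc: "X \<oplus>\<^bsub>?L\<^esub> Y \<oplus>\<^bsub>?L\<^esub> Z = X \<oplus>\<^bsub>?L\<^esub> (Y \<oplus>\<^bsub>?L\<^esub> Z)"
    "X \<otimes>\<^bsub>?L\<^esub> Y \<otimes>\<^bsub>?L\<^esub> Z = X \<otimes>\<^bsub>?L\<^esub> (Y \<otimes>\<^bsub>?L\<^esub> Z)"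
    "(X \<oplus>\<^bsub>?L\<^esub> Y) \<otimes>\<^bsub>?L\<^esub> Z = X \<otimes>\<^bsub>?L\<^esub> Z \<oplus>\<^bsub>?L\<^esub> Y \<otimes>\<^bsub>?L\<^esub> Z"
    if XYZ: "X \<in> carrier ?L" "Y \<in> carrier ?L" "Z \<in> carrier ?L" for X Y Z
  proof -
    obtain r s r' s' r'' s'' where h: "X = fraction R U r s" "Y = fraction R U r' s'"
      "Z = fraction R U r'' s''" "r \<in> carrier R" "s \<in> U" "r' \<in> carrier R" "s' \<in> U"
      "r'' \<in> carrier R" "s'' \<in> U"
      using XYZ unfolding carrier_iff by blast
    note c = h(4,6,8) h(5,7,9)[THEN U_carrier]
    show "X \<oplus>\<^bsub>?L\<^esub> Y \<oplus>\<^bsub>?L\<^esub> Z = X \<oplus>\<^bsub>?L\<^esub> (Y \<oplus>\<^bsub>?L\<^esub> Z)"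
      using h(4-) c by (simp add: h(1-3) loc) (rule fraction_eqI; simp add: U_carrier U_mult r_distr m_ac a_ac)
    show "X \<otimes>\<^bsub>?L\<^esub> Y \<otimes>\<^bsub>?L\<^esub> Z = X \<otimes>\<^bsub>?L\<^esub> (Y \<otimes>\<^bsub>?L\<^esub> Z)"
      using h(4-) c by (simp add: h(1-3) loc m_assoc)
    show "(X \<oplus>\<^bsub>?L\<^esub> Y) \<otimes>\<^bsub>?L\<^esub> Z = X \<otimes>\<^bsub>?L\<^esub> Z \<oplus>\<^bsub>?L\<^esub> Y \<otimes>\<^bsub>?L\<^esub> Z"
      using h(4-) c
      by (simp add: h(1-3) loc) (rule fraction_eqI; simp add: U_carrier U_mult l_distr r_distr m_ac a_ac)
  qed
  have comm: "X \<oplus>\<^bsub>?L\<^esub> Y = Y \<oplus>\<^bsub>?L\<^esub> X" "X \<otimes>\<^bsub>?L\<^esub> Y = Y \<otimes>\<^bsub>?L\<^esub> X"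
    "X \<oplus>\<^bsub>?L\<^esub> Y \<in> carrier ?L" "X \<otimes>\<^bsub>?L\<^esub> Y \<in> carrier ?L"
    if XY: "X \<in> carrier ?L" "Y \<in> carrier ?L" for X Y
  proof -
    obtain r s r' s' where h: "X = fraction R U r s" "Y = fraction R U r' s'"
      "r \<in> carrier R" "s \<in> U" "r' \<in> carrier R" "s' \<in> U"
      using XY unfolding carrier_iff by blast
    note c = h(3,5) h(4,6)[THEN U_carrier]
    show "X \<oplus>\<^bsub>?L\<^esub> Y = Y \<oplus>\<^bsub>?L\<^esub> X" "X \<otimes>\<^bsub>?L\<^esub> Y = Y \<otimes>\<^bsub>?L\<^esub> X"
      using h(3-) c by (simp_all add: h(1,2) loc m_comm a_comm)
    show "X \<oplus>\<^bsub>?L\<^esub> Y \<in> carrier ?L"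
      unfolding carrier_iff h(1,2) localization_add[OF h(3-6)]
      by (intro exI conjI, rule refl) (use h(3-) c U_mult in simp_all)
    show "X \<otimes>\<^bsub>?L\<^esub> Y \<in> carrier ?L"
      unfolding carrier_iff h(1,2) localization_mult[OF h(3-6)]
      by (intro exI conjI, rule refl) (use h(3-) c U_mult in simp_all)
  qed
  have one_zero: "\<one>\<^bsub>?L\<^esub> \<in> carrier ?L" "\<zero>\<^bsub>?L\<^esub> \<in> carrier ?L"
    unfolding carrier_iff localization_one localization_zero using U_one by blast+
  have unit: "\<one>\<^bsub>?L\<^esub> \<otimes>\<^bsub>?L\<^esub> X = X" "\<zero>\<^bsub>?L\<^esub> \<oplus>\<^bsub>?L\<^esub> X = X"
    "\<exists>Y\<in>carrier ?L. Y \<oplus>\<^bsub>?L\<^esub> X = \<zero>\<^bsub>?L\<^esub>" if X: "X \<in> carrier ?L" for X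
  proof -
    obtain r s where h: "X = fraction R U r s" "r \<in> carrier R" "s \<in> U"
      using X unfolding carrier_iff by blast
    show "\<one>\<^bsub>?L\<^esub> \<otimes>\<^bsub>?L\<^esub> X = X" "\<zero>\<^bsub>?L\<^esub> \<oplus>\<^bsub>?L\<^esub> X = X"
      using h by (simp_all add: loc)
    have "s \<otimes> (\<ominus> r) \<oplus> s \<otimes> r = \<zero>"
      using h U_carrier by (simp add: r_minus l_neg)
    then have "fraction R U (\<ominus> r) s \<oplus>\<^bsub>?L\<^esub> X = \<zero>\<^bsub>?L\<^esub>"
      using h U_carrier
      by (simp add: localization_add localization_zero) (rule fraction_eqI; simp add: U_carrier U_mult U_one)
    moreover have "fraction R U (\<ominus> r) s \<in> carrier ?L"
      unfolding carrier_iff using h by blast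
    ultimately show "\<exists>Y\<in>carrier ?L. Y \<oplus>\<^bsub>?L\<^esub> X = \<zero>\<^bsub>?L\<^esub>"
      by blast
  qed
  have "abelian_group ?L"
    by (rule abelian_groupI) (assumption | rule assoc comm one_zero unit)+
  moreover have "comm_monoid ?L"
    by (rule comm_monoidI) (assumption | rule assoc comm one_zero unit)+
  ultimately show ?thesis
    by (rule cringI) (rule assoc)
qed

end

lemma mult_set_compl_primeideal:
  assumes "primeideal P R"
  shows "mult_set R (carrier R - P)"
proof -
  interpret primeideal P R by fact
  show ?thesis
    by unfold_locales (use I_prime I_notcarr one_imp_carrier in auto)
qed

lemma monoid_span_keys_mult:
  assumes "Poly_Mapping.keys f \<subseteq> monoid_span A" "Poly_Mapping.keys g \<subseteq> monoid_span A"
  shows "Poly_Mapping.keys (f * g :: 'a::comm_monoid_add \<Rightarrow>\<^sub>0 'k::field) \<subseteq> monoid_span A"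
  using keys_mult[of f g] assms by (fastforce intro: monoid_span.add)

lemma cring_semigroup_ring:
  "cring (semigroup_ring (monoid_span A) :: ('a::comm_monoid_add \<Rightarrow>\<^sub>0 'k::field) ring)"
    (is "cring ?R")
proof (rule cringI)
  show "abelian_group ?R"
  proof (rule abelian_groupI)
    fix f assume "f \<in> carrier ?R"
    then show "\<exists>g\<in>carrier ?R. g \<oplus>\<^bsub>?R\<^esub> f = \<zero>\<^bsub>?R\<^esub>"
      by (intro bexI[of _ "- f"]) (auto simp: semigroup_ring_def)
  next
    fix f g assume "f \<in> carrier ?R" "g \<in> carrier ?R"
    then show "f \<oplus>\<^bsub>?R\<^esub> g \<in> carrier ?R"
      using Poly_Mapping.keys_add[of f g] by (auto simp: semigroup_ring_def)
  qed (auto simp: semigroup_ring_def ac_simps)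
  show "comm_monoid ?R"
    by (rule comm_monoidI)
      (auto simp: semigroup_ring_def ac_simps intro: monoid_span.zero
        dest: monoid_span_keys_mult[THEN subsetD, rotated 2])
qed (auto simp: semigroup_ring_def distrib_right)

end

theory Submission
  imports Defs "HOL-Library.Product_Lexorder"
begin

text \<open>
  With \<open>e\<^sub>1 = (d, 0)\<close> and \<open>e\<^sub>2 = (0, d)\<close>, the ring \<open>K[S]\<close> is Cohen--Macaulay iff \<open>x + e\<^sub>1 \<in> S\<close> and
  \<open>x + e\<^sub>2 \<in> S\<close> imply \<open>x \<in> S\<close>. If this holds and a maximal ideal has height two, it contains nonzero
  polynomials \<open>p\<close> in the monomial of \<open>e\<^sub>1\<close> and \<open>q\<close> in that of \<open>e\<^sub>2\<close>, and these form a regular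
  sequence. If it fails, the localization at the irrelevant maximal ideal has dimension two, but a
  monomial outside \<open>K[S]\<close> that multiplies this ideal into \<open>K[S]\<close> excludes regular sequences
  of length two.

  In terms of the \<open>n\<close>-fold sumsets, the condition says that \<open>p, p + d \<in> (n + 1)A\<^sub>1\<close> imply
  \<open>p \<in> nA\<^sub>1\<close>. The block of \<open>\<epsilon>\<close> consecutive elements, being at least as long as the first and
  last gaps of \<open>A\<^sub>1\<close>, propagates in both directions, so that only the elements to its left and to
  its right matter; these give (i) and (ii).
\<close>

text \<open>Cohen-Macaulayness quantifies over all maximal ideals of a ring over an arbitrary field,
  whose heights are not known beforehand. No height is computed: an arbitrary chain of primes below
  the maximal ideal is matched by a regular sequence of the same length. A chain of three primes
  makes every ring element algebraic over \<open>K\<close> modulo the top one. For the monomials of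
  \<open>(d, 0)\<close> and \<open>(0, d)\<close> this is the origin of \<open>p\<close> and
  \<open>q\<close>; for an element of a still larger prime it gives a contradiction.

  These two exponents suffice because \<open>d\<close> times any generator is a combination of them.
  Hence adding a large element of \<open>S\<close> repairs a failing exponent, and a failing
  exponent of maximal degree yields the monomial that excludes depth two.

  Descent can be iterated independently in both directions. So a point may be tested after
  arbitrarily many steps, when the block has spread far enough: a shift by at most
  \<open>\<epsilon>\<close> leaves no gap between the block and its translate. The reflection
  \<open>a \<mapsto> d - a\<close> exchanges the two directions, so (ii) is (i) for
  \<open>A\<^sub>2\<close>.\<close>

section \<open>Depth, dimension and localization\<close>

text \<open>The prime is a maximal one among the ideals containing \<open>I\<close> that avoid all \<open>x\<^sup>k u\<close> with
  \<open>u \<notin> Q\<close>; regularity of \<open>x\<close> keeps \<open>I\<close> itself away from these elements.\<close>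
lemma (in cring) primeideal_below_regular_element:
  assumes "ideal I R" "primeideal Q R" "I \<subseteq> Q" "x \<in> Q"
    and reg: "\<And>y. y \<in> carrier R \<Longrightarrow> x \<otimes> y \<in> I \<Longrightarrow> y \<in> I"
  shows "\<exists>P. primeideal P R \<and> I \<subseteq> P \<and> P \<subset> Q"
proof -
  interpret Q: primeideal Q R by fact
  interpret I: ideal I R by fact
  have x: "x \<in> carrier R"
    using assms(4) Q.Icarr by blast
  define T where "T = {x [^] (k::nat) \<otimes> u | k u. u \<in> carrier R - Q}"
  have T_mult: "s \<otimes> t \<in> T" if "s \<in> T" "t \<in> T" for s t
  proof -
    obtain k u l v where h: "s = x [^] (k::nat) \<otimes> u" "t = x [^] (l::nat) \<otimes> v"
      "u \<in> carrier R" "v \<in> carrier R" "u \<notin> Q" "v \<notin> Q"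
      using \<open>s \<in> T\<close> \<open>t \<in> T\<close> unfolding T_def by blast
    then have "s \<otimes> t = x [^] (k + l) \<otimes> (u \<otimes> v)"
      using x by (simp add: nat_pow_mult[OF x, of k l, symmetric] m_ac)
    moreover have "u \<otimes> v \<in> carrier R - Q"
      using h Q.I_prime by auto
    ultimately show ?thesis
      unfolding T_def by blast
  qed
  have "u \<in> I" if "u \<in> carrier R" "x [^] (k::nat) \<otimes> u \<in> I" for k u
    using that
  proof (induction k)
    case (Suc k)
    have "x \<otimes> (x [^] k \<otimes> u) \<in> I"
      using Suc.prems x by (simp add: m_ac)
    then show ?case
      using reg[of "x [^] k \<otimes> u"] Suc.IH Suc.prems(1) x by blast
  qed simp
  then have disj: "I \<inter> T = {}"
    unfolding T_def using assms(3) by blast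
  let ?A = "{J. ideal J R \<and> I \<subseteq> J \<and> J \<inter> T = {}}"
  have "\<exists>M\<in>?A. \<forall>X\<in>?A. M \<subseteq> X \<longrightarrow> X = M"
  proof (rule subset_Zorn_nonempty)
    show "?A \<noteq> {}"
      using assms(1) disj by blast
    fix C assume C: "C \<noteq> {}" "subset.chain ?A C"
    then have "subset.chain {J. ideal J R} C"
      unfolding pred_on.chain_def by blast
    then have "ideal (\<Union>C) R"
      using chain_Union_is_ideal[of C] C(1) by simp
    then show "\<Union>C \<in> ?A"
      using C unfolding pred_on.chain_def by blast
  qed
  then obtain P where "P \<in> ?A" and max: "\<forall>J\<in>?A. P \<subseteq> J \<longrightarrow> J = P"
    by (rule bexE)
  then have P: "ideal P R" "I \<subseteq> P" "P \<inter> T = {}"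
    by simp_all
  interpret P: ideal P R by fact
  have "u \<in> T" if "u \<in> carrier R - Q" for u
    unfolding T_def using that by (intro CollectI exI[of _ "0::nat"] exI[of _ u]) auto
  then have "P \<subseteq> Q"
    using P.Icarr P(3) by blast
  have "\<one> \<notin> Q"
    using Q.one_imp_carrier Q.I_notcarr by blast
  \<comment> \<open>The case \<open>k = 1\<close>, \<open>u = \<one>\<close>: it puts
    \<open>x\<close> outside \<open>P\<close>, so that \<open>P\<close> is strictly smaller than
    \<open>Q\<close>.\<close>
  then have "x \<in> T"
    unfolding T_def using x by (intro CollectI exI[of _ "1::nat"] exI[of _ \<one>]) auto
  then have "x \<notin> P"
    using P(3) by blast
  \<comment> \<open>By maximality of \<open>P\<close>, the strictly larger ideal generated by
    \<open>P\<close> and \<open>a\<close> must meet \<open>T\<close>.\<close>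
  have meet: "\<exists>p\<in>P. \<exists>r\<in>carrier R. p \<oplus> r \<otimes> a \<in> T" if a: "a \<in> carrier R" "a \<notin> P" for a
  proof (rule ccontr)
    assume no: "\<not> ?thesis"
    let ?J = "set_add R P (PIdl a)"
    have J: "y \<in> ?J \<longleftrightarrow> (\<exists>p\<in>P. \<exists>r\<in>carrier R. y = p \<oplus> r \<otimes> a)" for y
      unfolding set_add_def' cgenideal_def by blast
    have "ideal ?J R"
      using add_ideals P(1) cgenideal_ideal a(1) by blast
    moreover have "P \<subseteq> ?J"
    proof
      fix p assume "p \<in> P"
      then show "p \<in> ?J"
        unfolding J using a(1) P.Icarr by (intro bexI[of _ p] bexI[of _ \<zero>]) auto
    qed
    moreover have "?J \<inter> T = {}"
      using no by (auto simp: J)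
    ultimately have "?J = P"
      using max P(2) by simp
    moreover have "a \<in> ?J"
      unfolding J using a(1) by (intro bexI[of _ \<zero>] bexI[of _ \<one>]) auto
    ultimately show False
      using a(2) by blast
  qed
  have "primeideal P R"
  proof (rule primeidealI[OF P(1) is_cring])
    show "carrier R \<noteq> P"
      using \<open>x \<notin> P\<close> x by blast
    fix a b assume ab: "a \<in> carrier R" "b \<in> carrier R" "a \<otimes> b \<in> P"
    show "a \<in> P \<or> b \<in> P"
    proof (rule ccontr)
      assume "\<not> ?thesis"
      then have "a \<notin> P" "b \<notin> P"
        by simp_all
      obtain p r where h1: "p \<in> P" "r \<in> carrier R" "p \<oplus> r \<otimes> a \<in> T"
        using meet[OF ab(1) \<open>a \<notin> P\<close>] by (elim bexE)
      obtain q s where h2: "q \<in> P" "s \<in> carrier R" "q \<oplus> s \<otimes> b \<in> T"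
        using meet[OF ab(2) \<open>b \<notin> P\<close>] by (elim bexE)
      note h = h1 h2
      have pq: "p \<in> carrier R" "q \<in> carrier R"
        using h P.Icarr by auto
      \<comment> \<open>Every term has a factor \<open>p\<close>, \<open>q\<close> or
        \<open>a \<otimes> b\<close> from \<open>P\<close>, whereas a product of two elements of
        \<open>T\<close> stays in \<open>T\<close>.\<close>
      have "(p \<oplus> r \<otimes> a) \<otimes> (q \<oplus> s \<otimes> b) = p \<otimes> (q \<oplus> s \<otimes> b) \<oplus> (q \<otimes> (r \<otimes> a) \<oplus> (a \<otimes> b) \<otimes> (r \<otimes> s))"
        using h(2,5) ab(1,2) pq by (simp add: l_distr r_distr m_ac a_ac)
      also have "\<dots> \<in> P"
        using h(2,5) ab(1,2) pq
        by (intro P.a_closed P.I_r_closed[OF h(1)] P.I_r_closed[OF h(4)] P.I_r_closed[OF ab(3)]) auto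
      finally show False
        using T_mult[OF h(3,6)] P(3) by blast
    qed
  qed
  then show ?thesis
    using P(2) \<open>P \<subseteq> Q\<close> \<open>x \<notin> P\<close> assms(4) by blast
qed

text \<open>Removing the last element of a regular sequence makes room for a strictly smaller prime
  that still contains the remaining elements. Iterating, a sequence of length \<open>n\<close>
  inside \<open>M\<close> yields a chain of \<open>n + 1\<close> primes ending in
  \<open>M\<close>.\<close>

lemma (in cring) depth_le_krull_dim:
  assumes "primeideal M R"
  shows "depth R M \<le> krull_dim R"
proof -
  \<comment> \<open>The top prime \<open>Q\<close> is arbitrary so that the induction can continue
    below the smaller prime.\<close>
  have chain: "\<exists>P :: nat \<Rightarrow> 'a set. (\<forall>i\<le>length xs. primeideal (P i) R) \<and>
      (\<forall>i<length xs. P i \<subset> P (Suc i)) \<and> P (length xs) = Q"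
    if "primeideal Q R" "set xs \<subseteq> Q" "\<forall>i<length xs. \<forall>y\<in>carrier R.
        xs ! i \<otimes> y \<in> genideal R (set (take i xs)) \<longrightarrow> y \<in> genideal R (set (take i xs))" for xs Q
    using that
  proof (induction xs arbitrary: Q rule: rev_induct)
    case Nil
    then show ?case
      by (intro exI[of _ "\<lambda>_. Q"]) auto
  next
    case (snoc x ys)
    interpret Q: primeideal Q R by fact
    have sub: "set ys \<subseteq> Q" "x \<in> Q" "set ys \<subseteq> carrier R"
      using snoc.prems(2) Q.Icarr by auto
    have reg: "y \<in> Idl (set ys)" if "y \<in> carrier R" "x \<otimes> y \<in> Idl (set ys)" for y
      using snoc.prems(3)[rule_format, of "length ys" y] that by simp
    have "Idl (set ys) \<subseteq> Q"
      using genideal_minimal sub(1) Q.is_ideal by blast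
    from primeideal_below_regular_element[OF genideal_ideal[OF sub(3)] snoc.prems(1) this sub(2) reg]
    obtain Q' where Q': "primeideal Q' R" "Idl (set ys) \<subseteq> Q'" "Q' \<subset> Q"
      by blast
    have "set ys \<subseteq> Q'"
      using Q'(2) genideal_self[OF sub(3)] by blast
    moreover have "\<forall>i<length ys. \<forall>y\<in>carrier R.
        ys ! i \<otimes> y \<in> Idl (set (take i ys)) \<longrightarrow> y \<in> Idl (set (take i ys))"
    proof (intro allI impI)
      fix i assume "i < length ys"
      then show "\<forall>y\<in>carrier R. ys ! i \<otimes> y \<in> Idl (set (take i ys)) \<longrightarrow> y \<in> Idl (set (take i ys))"
        using snoc.prems(3)[rule_format, of i] by (auto simp: nth_append)
    qed
    ultimately obtain P where P: "\<forall>i\<le>length ys. primeideal (P i) R"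
      "\<forall>i<length ys. P i \<subset> P (Suc i)" "P (length ys) = Q'"
      using snoc.IH[OF Q'(1)] by blast
    have "\<forall>i\<le>Suc (length ys). primeideal ((P(Suc (length ys) := Q)) i) R"
      using P(1) snoc.prems(1) by (simp add: le_Suc_eq)
    moreover have "\<forall>i<Suc (length ys).
        (P(Suc (length ys) := Q)) i \<subset> (P(Suc (length ys) := Q)) (Suc i)"
      using P(2,3) Q'(3) by (simp add: less_Suc_eq)
    ultimately show ?case
      by (intro exI[of _ "P(Suc (length ys) := Q)"]) simp
  qed
  show ?thesis
    unfolding depth_def krull_dim_def
  proof (rule Sup_mono)
    fix e assume "e \<in> {enat (length xs) |xs. regular_sequence R xs \<and> set xs \<subseteq> M}"
    then obtain xs where "e = enat (length xs)" "regular_sequence R xs" "set xs \<subseteq> M"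
      by blast
    with chain[OF assms, of xs]
    show "\<exists>e'\<in>{enat n |n. \<exists>P. (\<forall>i\<le>n. primeideal (P i) R) \<and> (\<forall>i<n. P i \<subset> P (Suc i))}. e \<le> e'"
      unfolding regular_sequence_def by blast
  qed
qed

section \<open>Contraction and extension of ideals along a localization\<close>

context mult_set
begin

abbreviation frac where "frac \<equiv> fraction R U"

sublocale loc: cring "localization R U"
  by (rule cring_localization)

lemma frac_closed: "r \<in> carrier R \<Longrightarrow> s \<in> U \<Longrightarrow> frac r s \<in> carrier (localization R U)"
  unfolding carrier_localization by blast

lemma frac_mult_left:
  assumes "r \<in> carrier R" "s \<in> U" "t \<in> U"
  shows "frac (t \<otimes> r) (t \<otimes> s) = frac r s"
  using assms by (intro fraction_eqI) (auto simp: U_mult U_carrier m_ac)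

lemma frac_mem_ideal_iff:
  assumes "ideal J (localization R U)" "r \<in> carrier R" "s \<in> U"
  shows "frac r s \<in> J \<longleftrightarrow> frac r \<one> \<in> J"
proof -
  interpret J: ideal J "localization R U" by fact
  have "frac s \<one> \<otimes>\<^bsub>localization R U\<^esub> frac r s = frac r \<one>"
    using assms U_one U_carrier frac_mult_left[of r \<one> s] by (simp add: localization_mult)
  moreover have "frac \<one> s \<otimes>\<^bsub>localization R U\<^esub> frac r \<one> = frac r s"
    using assms U_one U_carrier by (simp add: localization_mult)
  ultimately show ?thesis
    using J.I_l_closed[of "frac r s" "frac s \<one>"] J.I_l_closed[of "frac r \<one>" "frac \<one> s"]
      frac_closed assms U_one U_carrier by auto
qed

text \<open>The preimage of \<open>J\<close> under the canonical map
  \<open>r \<mapsto> frac r \<one>\<close>.\<close>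

definition contraction where
  "contraction J = {r \<in> carrier R. frac r \<one> \<in> J}"

lemma frac_mem_iff_contraction:
  assumes "ideal J (localization R U)" "r \<in> carrier R" "s \<in> U"
  shows "frac r s \<in> J \<longleftrightarrow> r \<in> contraction J"
  using frac_mem_ideal_iff[OF assms] assms(2) unfolding contraction_def by simp

lemma ideal_contraction:
  assumes "ideal J (localization R U)"
  shows "ideal (contraction J) R"
proof -
  interpret J: ideal J "localization R U" by fact
  have add: "frac r \<one> \<oplus>\<^bsub>localization R U\<^esub> frac s \<one> = frac (r \<oplus> s) \<one>"
    if "r \<in> carrier R" "s \<in> carrier R" for r s
    using that U_one by (simp add: localization_add)
  have mul: "frac r \<one> \<otimes>\<^bsub>localization R U\<^esub> frac s \<one> = frac (r \<otimes> s) \<one>"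
    if "r \<in> carrier R" "s \<in> carrier R" for r s
    using that U_one by (simp add: localization_mult)
  have lmul: "x \<otimes> r \<in> contraction J" if "r \<in> contraction J" "x \<in> carrier R" for r x
    using that J.I_l_closed[of "frac r \<one>" "frac x \<one>"] frac_closed U_one
    unfolding contraction_def by (auto simp: mul)
  show ?thesis
  proof (rule idealI[OF ring_axioms])
    show "subgroup (contraction J) (add_monoid R)"
    proof (rule add.subgroupI)
      show "contraction J \<subseteq> carrier R" "contraction J \<noteq> {}"
        using J.zero_closed unfolding contraction_def localization_zero by auto
      show "a \<oplus> b \<in> contraction J" if "a \<in> contraction J" "b \<in> contraction J" for a b
        using that J.a_closed[of "frac a \<one>" "frac b \<one>"]
        unfolding contraction_def by (auto simp: add)
      show "\<ominus> a \<in> contraction J" if "a \<in> contraction J" for a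
      proof -
        have a: "a \<in> carrier R"
          using that unfolding contraction_def by blast
        then have "\<ominus> a = (\<ominus> \<one>) \<otimes> a"
          by (simp add: l_minus)
        then show ?thesis
          using lmul[OF that] by simp
      qed
    qed
    show "x \<otimes> a \<in> contraction J" if "a \<in> contraction J" "x \<in> carrier R" for a x
      using lmul that by blast
    show "a \<otimes> x \<in> contraction J" if "a \<in> contraction J" "x \<in> carrier R" for a x
      using lmul[OF that] that by (subst m_comm) (auto simp: contraction_def)
  qed
qed

lemma contraction_mono:
  assumes "J \<subseteq> J'"
  shows "contraction J \<subseteq> contraction J'"
  using assms unfolding contraction_def by blast

text \<open>Denominators are units, so the numerator of a fraction in \<open>J' - J\<close> already
  separates the contractions.\<close>

lemma contraction_strict_mono:
  assumes "ideal J (localization R U)" "ideal J' (localization R U)" "J \<subset> J'"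
  shows "contraction J \<subset> contraction J'"
proof -
  interpret J': ideal J' "localization R U" by fact
  obtain X where X: "X \<in> J'" "X \<notin> J"
    using assms(3) by blast
  then obtain r s where "X = frac r s" "r \<in> carrier R" "s \<in> U"
    using J'.Icarr unfolding carrier_localization by blast
  then have "r \<in> contraction J'" "r \<notin> contraction J"
    using X frac_mem_iff_contraction assms(1,2) by auto
  then show ?thesis
    using contraction_mono assms(3) by blast
qed

lemma primeideal_contraction:
  assumes "primeideal J (localization R U)"
  shows "primeideal (contraction J) R" "contraction J \<inter> U = {}"
proof -
  interpret J: primeideal J "localization R U" by fact
  have one: "\<one> \<notin> contraction J"
    using J.one_imp_carrier J.I_notcarr unfolding contraction_def localization_one by blast
  show "primeideal (contraction J) R"
  proof (rule primeidealI[OF ideal_contraction[OF J.is_ideal] is_cring])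
    show "carrier R \<noteq> contraction J"
      using one by blast
    show "a \<in> contraction J \<or> b \<in> contraction J"
      if "a \<in> carrier R" "b \<in> carrier R" "a \<otimes> b \<in> contraction J" for a b
    proof -
      have "frac a \<one> \<otimes>\<^bsub>localization R U\<^esub> frac b \<one> \<in> J"
        using that U_one unfolding contraction_def by (simp add: localization_mult)
      then show ?thesis
        using J.I_prime frac_closed that U_one unfolding contraction_def by blast
    qed
  qed
  have "s \<notin> contraction J" if "s \<in> U" for s
  proof -
    have "frac s s = frac \<one> \<one>"
      using that U_one U_carrier by (intro fraction_eqI) auto
    then have "frac s s \<notin> J"
      using one unfolding contraction_def by simp
    then show ?thesis
      using frac_mem_iff_contraction[OF J.is_ideal] that U_carrier by blast
  qed
  then show "contraction J \<inter> U = {}"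
    by blast
qed

lemma contraction_subset:
  assumes "primeideal J (localization R U)" "U = carrier R - M"
  shows "contraction J \<subseteq> M"
proof
  fix r assume r: "r \<in> contraction J"
  then have "r \<notin> U"
    using primeideal_contraction(2)[OF assms(1)] by blast
  moreover have "r \<in> carrier R"
    using r unfolding contraction_def by blast
  ultimately show "r \<in> M"
    using assms(2) by blast
qed

text \<open>The images of finitely many generators of the contraction generate \<open>J\<close>,
  because every fraction in \<open>J\<close> has its numerator in the contraction.\<close>

lemma noetherian_ring_localization:
  assumes "noetherian_ring R"
  shows "noetherian_ring (localization R U)"
proof (rule loc.noetherian_ringI)
  fix J assume J: "ideal J (localization R U)"
  interpret J: ideal J "localization R U" by fact
  obtain A where A: "A \<subseteq> carrier R" "finite A" "contraction J = Idl A"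
    using noetherian_ring.finetely_gen[OF assms ideal_contraction[OF J]] by blast
  let ?B = "(\<lambda>a. frac a \<one>) ` A"
  let ?K = "genideal (localization R U) ?B"
  have B: "?B \<subseteq> carrier (localization R U)"
    using A(1) frac_closed U_one by blast
  have K: "ideal ?K (localization R U)"
    using loc.genideal_ideal[OF B] .
  have "A \<subseteq> contraction ?K"
    using A(1) loc.genideal_self[OF B] unfolding contraction_def by blast
  then have sub: "contraction J \<subseteq> contraction ?K"
    unfolding A(3) using genideal_minimal ideal_contraction[OF K] by blast
  have "J \<subseteq> ?K"
  proof
    fix X assume X: "X \<in> J"
    then obtain r s where "X = frac r s" "r \<in> carrier R" "s \<in> U"
      using J.Icarr unfolding carrier_localization by blast
    then show "X \<in> ?K"
      using X sub frac_mem_iff_contraction J K by blast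
  qed
  moreover have "A \<subseteq> contraction J"
    unfolding A(3) by (rule genideal_self[OF A(1)])
  then have "?K \<subseteq> J"
    by (intro loc.genideal_minimal[OF J]) (auto simp: contraction_def)
  ultimately show "\<exists>A\<subseteq>carrier (localization R U). finite A \<and> J = genideal (localization R U) A"
    using A(2) B by blast
qed

text \<open>For an ideal \<open>I\<close>, common denominators make this set closed under addition,
  so it is already the ideal generated by the image of \<open>I\<close>.\<close>

definition extension where
  "extension I = {frac r s | r s. r \<in> I \<and> s \<in> U}"

lemma extensionI: "r \<in> I \<Longrightarrow> s \<in> U \<Longrightarrow> frac r s \<in> extension I"
  unfolding extension_def by blast

lemma ideal_extension:
  assumes "ideal I R"
  shows "ideal (extension I) (localization R U)"
proof -
  interpret I: ideal I R by fact
  have lmul: "X \<otimes>\<^bsub>localization R U\<^esub> Y \<in> extension I"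
    if Y: "Y \<in> extension I" and X: "X \<in> carrier (localization R U)" for X Y
  proof -
    obtain r s where h1: "Y = frac r s" "r \<in> I" "s \<in> U"
      using Y unfolding extension_def by blast
    obtain r' s' where h2: "X = frac r' s'" "r' \<in> carrier R" "s' \<in> U"
      using X unfolding carrier_localization by blast
    note h = h1 h2
    then have "X \<otimes>\<^bsub>localization R U\<^esub> Y = frac (r' \<otimes> r) (s' \<otimes> s)"
      using I.Icarr by (simp add: localization_mult)
    then show ?thesis
      using h by (simp add: extensionI I.I_l_closed U_mult)
  qed
  have sub: "extension I \<subseteq> carrier (localization R U)"
    unfolding extension_def carrier_localization using I.Icarr by blast
  show ?thesis
  proof (rule idealI[OF loc.ring_axioms])
    show "subgroup (extension I) (add_monoid (localization R U))"
    proof (rule loc.add.subgroupI)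
      show "extension I \<subseteq> carrier (localization R U)"
        by (rule sub)
      show "extension I \<noteq> {}"
        using extensionI[OF I.zero_closed U_one] by blast
      show "a \<oplus>\<^bsub>localization R U\<^esub> b \<in> extension I" if ab: "a \<in> extension I" "b \<in> extension I" for a b
      proof -
        obtain r s r' s' where h: "a = frac r s" "r \<in> I" "s \<in> U" "b = frac r' s'" "r' \<in> I" "s' \<in> U"
          using ab unfolding extension_def by blast
        then have "a \<oplus>\<^bsub>localization R U\<^esub> b = frac (s' \<otimes> r \<oplus> s \<otimes> r') (s \<otimes> s')"
          using I.Icarr by (simp add: localization_add)
        moreover have "s' \<otimes> r \<oplus> s \<otimes> r' \<in> I"
          using h by (intro I.a_closed I.I_l_closed) (auto simp: U_carrier)
        ultimately show ?thesis
          using h by (simp add: extensionI U_mult)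
      qed
      show "\<ominus>\<^bsub>localization R U\<^esub> a \<in> extension I" if "a \<in> extension I" for a
      proof -
        have "a \<in> carrier (localization R U)"
          using that sub by blast
        then have "\<ominus>\<^bsub>localization R U\<^esub> a = (\<ominus>\<^bsub>localization R U\<^esub> \<one>\<^bsub>localization R U\<^esub>) \<otimes>\<^bsub>localization R U\<^esub> a"
          by (simp add: loc.l_minus)
        then show ?thesis
          using lmul[OF that] by simp
      qed
    qed
    show "X \<otimes>\<^bsub>localization R U\<^esub> Y \<in> extension I"
      if "Y \<in> extension I" "X \<in> carrier (localization R U)" for X Y
      using lmul that by blast
    show "Y \<otimes>\<^bsub>localization R U\<^esub> X \<in> extension I"
      if "Y \<in> extension I" "X \<in> carrier (localization R U)" for X Y
      using lmul[OF that] that sub by (subst loc.m_comm) auto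
  qed
qed

text \<open>Equal fractions agree only after multiplication by some \<open>u \<in> U\<close>; since
  \<open>Q\<close> is prime and disjoint from \<open>U\<close>, the factor \<open>u\<close> and the
  denominator can be cancelled.\<close>

lemma frac_mem_extension_iff:
  assumes "primeideal Q R" "Q \<inter> U = {}" "r \<in> carrier R" "s \<in> U"
  shows "frac r s \<in> extension Q \<longleftrightarrow> r \<in> Q"
proof
  interpret Q: primeideal Q R by fact
  assume "frac r s \<in> extension Q"
  then obtain r' s' where h: "frac r s = frac r' s'" "r' \<in> Q" "s' \<in> U"
    unfolding extension_def by blast
  then obtain u where u: "u \<in> U" "u \<otimes> (s' \<otimes> r) = u \<otimes> (s \<otimes> r')"
    using fraction_eq_iff[of r s r' s'] assms Q.Icarr by blast
  moreover have "u \<otimes> (s \<otimes> r') \<in> Q"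
    using h(2) assms(4) u(1) U_carrier Q.I_l_closed by blast
  ultimately have "(u \<otimes> s') \<otimes> r \<in> Q"
    using U_carrier h(3) assms(3) by (simp add: m_assoc)
  then show "r \<in> Q"
    using Q.I_prime[of "u \<otimes> s'" r] assms(2,3) u(1) h(3) U_mult U_carrier by blast
qed (use assms(4) in \<open>auto simp: extension_def\<close>)

lemma primeideal_extension:
  assumes "primeideal Q R" "Q \<inter> U = {}"
  shows "primeideal (extension Q) (localization R U)"
proof -
  interpret Q: primeideal Q R by fact
  note mem = frac_mem_extension_iff[OF assms]
  show ?thesis
  proof (rule primeidealI[OF ideal_extension[OF Q.is_ideal] loc.is_cring])
    have "frac \<one> \<one> \<notin> extension Q"
      using mem[of \<one> \<one>] U_one assms(2) by auto
    then show "carrier (localization R U) \<noteq> extension Q"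
      using frac_closed U_one by blast
    fix X Y
    assume XY: "X \<in> carrier (localization R U)" "Y \<in> carrier (localization R U)"
      "X \<otimes>\<^bsub>localization R U\<^esub> Y \<in> extension Q"
    then obtain r s r' s' where h: "X = frac r s" "r \<in> carrier R" "s \<in> U"
      "Y = frac r' s'" "r' \<in> carrier R" "s' \<in> U"
      unfolding carrier_localization by blast
    then have "r \<otimes> r' \<in> Q"
      using XY(3) mem[of "r \<otimes> r'" "s \<otimes> s'"] U_mult by (simp add: localization_mult)
    then show "X \<in> extension Q \<or> Y \<in> extension Q"
      using h mem Q.I_prime by blast
  qed
qed

lemma extension_strict_mono:
  assumes "primeideal Q R" "Q \<inter> U = {}" "primeideal Q' R" "Q' \<inter> U = {}" "Q \<subset> Q'"
  shows "extension Q \<subset> extension Q'"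
proof -
  interpret Q': primeideal Q' R by fact
  obtain r where "r \<in> Q'" "r \<notin> Q"
    using assms(5) by blast
  then have "frac r \<one> \<in> extension Q'" "frac r \<one> \<notin> extension Q"
    using frac_mem_extension_iff assms Q'.Icarr U_one by auto
  moreover have "extension Q \<subseteq> extension Q'"
    using assms(5) unfolding extension_def by blast
  ultimately show ?thesis
    by blast
qed

text \<open>A fraction outside \<open>extension P\<close> has its numerator in \<open>U\<close> and
  is a unit; hence every proper ideal lies in \<open>extension P\<close>.\<close>

lemma maximalideal_localization_iff:
  assumes P: "primeideal P R" and U: "U = carrier R - P"
  shows "maximalideal N (localization R U) \<longleftrightarrow> N = extension P"
proof -
  interpret P: primeideal P R by fact
  have PU: "P \<inter> U = {}"
    using U by blast
  interpret E: primeideal "extension P" "localization R U"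
    using primeideal_extension[OF P PU] .
  have sub: "J \<subseteq> extension P" if J: "ideal J (localization R U)" "J \<noteq> carrier (localization R U)" for J
  proof
    interpret J: ideal J "localization R U" by fact
    fix X assume X: "X \<in> J"
    then obtain r s where h: "X = frac r s" "r \<in> carrier R" "s \<in> U"
      using J.Icarr unfolding carrier_localization by blast
    show "X \<in> extension P"
    proof (rule ccontr)
      assume "X \<notin> extension P"
      then have r: "r \<in> U"
        using h U unfolding extension_def by blast
      then have "frac s r \<otimes>\<^bsub>localization R U\<^esub> X = frac \<one> \<one>"
        using h U_carrier U_mult U_one
        by (simp add: localization_mult) (intro fraction_eqI; simp add: U_mult m_comm)
      then have "\<one>\<^bsub>localization R U\<^esub> \<in> J"
        using J.I_l_closed[OF X frac_closed[of s r]] r h U_carrier by (simp add: localization_one)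
      then show False
        using J.one_imp_carrier J(2) by blast
    qed
  qed
  have max: "maximalideal (extension P) (localization R U)"
  proof (rule maximalidealI[OF E.is_ideal E.I_notcarr])
    fix J assume "ideal J (localization R U)" "extension P \<subseteq> J" "J \<subseteq> carrier (localization R U)"
    then show "J = extension P \<or> J = carrier (localization R U)"
      using sub by blast
  qed
  show ?thesis
  proof
    assume "maximalideal N (localization R U)"
    then interpret N: maximalideal N "localization R U" .
    have "N \<subseteq> extension P"
      using sub N.is_ideal N.I_notcarr by blast
    then show "N = extension P"
      using N.I_maximal[OF E.is_ideal] E.a_subset E.I_notcarr by blast
  qed (use max in simp)
qed

end

section \<open>Regular sequences in localizations of domains\<close>

context mult_set
begin

lemma fraction_eq_iff_domain:
  assumes "domain R" "\<zero> \<notin> U" "r \<in> carrier R" "s \<in> U" "r' \<in> carrier R" "s' \<in> U"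
  shows "frac r s = frac r' s' \<longleftrightarrow> s' \<otimes> r = s \<otimes> r'"
proof -
  interpret domain R by fact
  have "u \<otimes> x = u \<otimes> y \<longleftrightarrow> x = y" if "u \<in> U" "x \<in> carrier R" "y \<in> carrier R" for u x y
    using that assms(2) U_carrier m_lcancel[of u x y] by auto
  then show ?thesis
    using assms(3-) U_carrier U_one by (subst fraction_eq_iff) auto
qed

lemma genideal_empty: "genideal (localization R U) {} = {\<zero>\<^bsub>localization R U\<^esub>}"
  using loc.genideal_minimal[OF loc.zeroideal, of "{}"]
    additive_subgroup.zero_closed[OF ideal.axioms(1)[OF loc.genideal_ideal[of "{}"]]] by blast

text \<open>Clears denominators: the unit \<open>s\<close> can be absorbed into \<open>w\<close> in
  one direction and into \<open>t\<close> in the other.\<close>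

lemma mem_genideal_frac_iff:
  assumes "domain R" "\<zero> \<notin> U" "p \<in> carrier R" "r \<in> carrier R" "s \<in> U"
  shows "frac r s \<in> genideal (localization R U) {frac p \<one>} \<longleftrightarrow>
    (\<exists>w\<in>carrier R. \<exists>t\<in>U. t \<otimes> r = p \<otimes> w)"
proof -
  have P: "frac p \<one> \<in> carrier (localization R U)"
    using assms(3) U_one by (rule frac_closed)
  have "frac r s \<in> genideal (localization R U) {frac p \<one>} \<longleftrightarrow>
      (\<exists>W\<in>carrier (localization R U). frac r s = W \<otimes>\<^bsub>localization R U\<^esub> frac p \<one>)"
    unfolding loc.cgenideal_eq_genideal[OF P, symmetric] cgenideal_def by blast
  also have "\<dots> \<longleftrightarrow> (\<exists>w\<in>carrier R. \<exists>t\<in>U. frac r s = frac w t \<otimes>\<^bsub>localization R U\<^esub> frac p \<one>)"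
    unfolding carrier_localization by blast
  also have "\<dots> \<longleftrightarrow> (\<exists>w\<in>carrier R. \<exists>t\<in>U. t \<otimes> r = s \<otimes> (w \<otimes> p))"
    using assms U_one U_carrier
    by (intro bex_cong refl)
      (simp add: localization_mult fraction_eq_iff_domain[OF assms(1,2)] U_mult)
  also have "\<dots> \<longleftrightarrow> (\<exists>w\<in>carrier R. \<exists>t\<in>U. t \<otimes> r = p \<otimes> w)"
  proof (intro iffI; elim bexE)
    fix w t assume "w \<in> carrier R" "t \<in> U" "t \<otimes> r = s \<otimes> (w \<otimes> p)"
    then show "\<exists>w\<in>carrier R. \<exists>t\<in>U. t \<otimes> r = p \<otimes> w"
      using assms(3,5) U_carrier by (intro bexI[of _ "s \<otimes> w"] bexI[of _ t]) (auto simp: m_ac)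
  next
    fix w t assume "w \<in> carrier R" "t \<in> U" "t \<otimes> r = p \<otimes> w"
    then show "\<exists>w\<in>carrier R. \<exists>t\<in>U. t \<otimes> r = s \<otimes> (w \<otimes> p)"
      using assms(3-5) U_carrier U_mult
      by (intro bexI[of _ w] bexI[of _ "s \<otimes> t"]) (auto simp: m_assoc m_comm[of w p])
  qed
  finally show ?thesis .
qed

lemma frac_nonzero_divisor:
  assumes "domain R" "\<zero> \<notin> U" "p \<in> carrier R" "p \<noteq> \<zero>" "Y \<in> carrier (localization R U)"
    and "frac p \<one> \<otimes>\<^bsub>localization R U\<^esub> Y = \<zero>\<^bsub>localization R U\<^esub>"
  shows "Y = \<zero>\<^bsub>localization R U\<^esub>"
proof -
  interpret domain R by fact
  obtain r s where Y: "Y = frac r s" "r \<in> carrier R" "s \<in> U"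
    using assms(5) unfolding carrier_localization by blast
  then have "p \<otimes> r = \<zero>"
    using assms(3,6) U_one U_carrier
    by (simp add: localization_mult localization_zero fraction_eq_iff_domain[OF assms(1,2)])
  then have "r = \<zero>"
    using integral[of p r] Y(2) assms(3,4) by simp
  then show ?thesis
    using Y U_one U_carrier by (simp add: localization_zero fraction_eq_iff_domain[OF assms(1,2)])
qed

lemma regular_sequence_single:
  assumes "domain R" "\<zero> \<notin> U" "p \<in> carrier R" "p \<noteq> \<zero>"
    and J: "ideal J (localization R U)" "J \<noteq> carrier (localization R U)" "frac p \<one> \<in> J"
  shows "regular_sequence (localization R U) [frac p \<one>]"
proof -
  have "genideal (localization R U) {frac p \<one>} \<subseteq> J"
    using loc.genideal_minimal[OF J(1)] J(3) by simp
  moreover have "J \<subseteq> carrier (localization R U)"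
    by (rule additive_subgroup.a_subset[OF ideal.axioms(1)[OF J(1)]])
  ultimately have "genideal (localization R U) {frac p \<one>} \<noteq> carrier (localization R U)"
    using J(2) by blast
  then show ?thesis
    unfolding regular_sequence_def
    using frac_nonzero_divisor[OF assms(1-4)] frac_closed[OF assms(3) U_one] by (auto simp: genideal_empty)
qed

text \<open>The assumption \<open>reg\<close> says that \<open>q\<close> is a nonzerodivisor modulo
  \<open>p\<close> in \<open>R\<close>; relations between fractions reduce to it by clearing
  denominators. The proper ideal \<open>J\<close> certifies that the pair does not generate the unit
  ideal.\<close>

lemma regular_sequence_pair:
  assumes "domain R" "\<zero> \<notin> U" "p \<in> carrier R" "p \<noteq> \<zero>" "q \<in> carrier R"
    and reg: "\<And>y z. y \<in> carrier R \<Longrightarrow> z \<in> carrier R \<Longrightarrow> q \<otimes> y = p \<otimes> z \<Longrightarrow> \<exists>w\<in>carrier R. y = p \<otimes> w"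
    and J: "ideal J (localization R U)" "J \<noteq> carrier (localization R U)" "frac p \<one> \<in> J" "frac q \<one> \<in> J"
  shows "regular_sequence (localization R U) [frac p \<one>, frac q \<one>]"
proof -
  have "genideal (localization R U) {frac p \<one>, frac q \<one>} \<subseteq> J"
    using loc.genideal_minimal[OF J(1)] J(3,4) by simp
  moreover have "J \<subseteq> carrier (localization R U)"
    by (rule additive_subgroup.a_subset[OF ideal.axioms(1)[OF J(1)]])
  ultimately have "genideal (localization R U) {frac p \<one>, frac q \<one>} \<noteq> carrier (localization R U)"
    using J(2) by blast
  moreover have "Y \<in> genideal (localization R U) {frac p \<one>}"
    if Y: "Y \<in> carrier (localization R U)"
      "frac q \<one> \<otimes>\<^bsub>localization R U\<^esub> Y \<in> genideal (localization R U) {frac p \<one>}" for Y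
  proof -
    obtain r s where rs: "Y = frac r s" "r \<in> carrier R" "s \<in> U"
      using Y(1) unfolding carrier_localization by blast
    then have "frac (q \<otimes> r) s \<in> genideal (localization R U) {frac p \<one>}"
      using Y(2) assms(5) U_one U_carrier by (simp add: localization_mult)
    then obtain w t where wt: "w \<in> carrier R" "t \<in> U" "t \<otimes> (q \<otimes> r) = p \<otimes> w"
      using mem_genideal_frac_iff[OF assms(1-3), of "q \<otimes> r" s] rs assms(5) by blast
    then have "q \<otimes> (t \<otimes> r) = p \<otimes> w"
      using assms(5) rs(2) U_carrier by (simp add: m_ac)
    then obtain v where "v \<in> carrier R" "t \<otimes> r = p \<otimes> v"
      using reg[of "t \<otimes> r" w] wt rs(2) U_carrier by blast
    then show ?thesis
      unfolding rs(1) using mem_genideal_frac_iff[OF assms(1-3) rs(2,3)] wt(2) by blast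
  qed
  moreover have "Y = \<zero>\<^bsub>localization R U\<^esub>"
    if "Y \<in> carrier (localization R U)" "frac p \<one> \<otimes>\<^bsub>localization R U\<^esub> Y = \<zero>\<^bsub>localization R U\<^esub>" for Y
    using frac_nonzero_divisor[OF assms(1-4)] that .
  ultimately show ?thesis
    unfolding regular_sequence_def
    using frac_closed[OF assms(3) U_one] frac_closed[OF assms(5) U_one]
    by (auto simp: genideal_empty less_Suc_eq nth_Cons')
qed

end

lemma le_depthI:
  assumes "regular_sequence R xs" "set xs \<subseteq> I"
  shows "enat (length xs) \<le> depth R I"
  unfolding depth_def by (rule Sup_upper) (use assms in blast)

lemma le_depthE:
  assumes "enat (Suc n) \<le> depth R I"
  obtains xs where "regular_sequence R xs" "set xs \<subseteq> I" "Suc n \<le> length xs"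
proof (rule ccontr)
  assume "\<not> thesis"
  with that have no: "length xs \<le> n" if "regular_sequence R xs" "set xs \<subseteq> I" for xs
    using \<open>regular_sequence R xs\<close> \<open>set xs \<subseteq> I\<close> not_less_eq_eq by blast
  have "depth R I \<le> enat n"
    unfolding depth_def by (rule Sup_least) (use no in auto)
  then show False
    using assms by (metis Suc_n_not_le_n enat_ord_simps(1) order_trans)
qed

section \<open>Leading exponents and Noetherian semigroup rings\<close>

lemma monoid_span_mono:
  assumes "A \<subseteq> B"
  shows "monoid_span A \<subseteq> monoid_span B"
proof
  fix x assume "x \<in> monoid_span A"
  then show "x \<in> monoid_span B"
    by induction (use assms in \<open>auto intro: monoid_span.intros\<close>)
qed

text \<open>Multiples of \<open>g\<close> are encoded as constant sums, which make sense in every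
  commutative monoid.\<close>

lemma sum_const_lessThan_add:
  fixes g :: "'a::comm_monoid_add"
  shows "(\<Sum>i<a + b. g) = (\<Sum>i<a. g) + (\<Sum>i<(b::nat). g)"
  by (induction b) (simp_all add: add.assoc)

lemma monoid_span_multiple: "g \<in> monoid_span A \<Longrightarrow> (\<Sum>i<(n::nat). g) \<in> monoid_span A"
  for g :: "'a::comm_monoid_add"
  by (induction n) (simp_all add: monoid_span.zero monoid_span.add)

lemma monoid_span_insert_cases:
  fixes g :: "'a::comm_monoid_add"
  assumes "x \<in> monoid_span (insert g A)"
  obtains n m where "m \<in> monoid_span A" "x = (\<Sum>i<(n::nat). g) + m"
proof -
  have "\<exists>n. \<exists>m\<in>monoid_span A. x = (\<Sum>i<(n::nat). g) + m"
    using assms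
  proof induction
    case zero
    show ?case
      by (intro exI[of _ 0] bexI[of _ 0]) (auto intro: monoid_span.zero)
  next
    case (gen x)
    show ?case
    proof (cases "x = g")
      case True
      then show ?thesis
        by (intro exI[of _ 1] bexI[of _ 0]) (auto intro: monoid_span.zero)
    next
      case False
      then show ?thesis
        using gen by (intro exI[of _ 0] bexI[of _ x]) (auto intro: monoid_span.gen)
    qed
  next
    case (add x y)
    then obtain n m n' m' where h: "m \<in> monoid_span A" "x = (\<Sum>i<(n::nat). g) + m"
      "m' \<in> monoid_span A" "y = (\<Sum>i<(n'::nat). g) + m'"
      by blast
    then have "x + y = (\<Sum>i<n + n'. g) + (m + m')"
      by (simp only: sum_const_lessThan_add ac_simps)
    with h show ?case
      using monoid_span.add by blast
  qed
  then show ?thesis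
    using that by blast
qed

lemma nat_mono_subsequence:
  fixes c :: "nat \<Rightarrow> nat"
  obtains r where "strict_mono (r :: nat \<Rightarrow> nat)" "mono (\<lambda>n. c (r n))"
proof -
  obtain r where r: "strict_mono (r :: nat \<Rightarrow> nat)" "monoseq (\<lambda>n. c (r n))"
    using seq_monosub[of c] by blast
  show ?thesis
  proof (cases "incseq (\<lambda>n. c (r n))")
    case True
    then show ?thesis
      using r that by blast
  next
    case False
    then have dec: "decseq (\<lambda>n. c (r n))"
      using r(2) monoseq_iff by blast
    \<comment> \<open>A nonincreasing sequence of naturals is constant from the point where it
      attains its minimum; that tail is also nondecreasing.\<close>
    define v where "v = (LEAST v. \<exists>n. v = c (r n))"
    obtain N where N: "v = c (r N)"
      unfolding v_def using LeastI[of "\<lambda>v. \<exists>n. v = c (r n)"] by blast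
    have "c (r (N + n)) = v" for n
    proof (rule antisym)
      show "c (r (N + n)) \<le> v"
        using dec N unfolding decseq_def by simp
      show "v \<le> c (r (N + n))"
        unfolding v_def by (rule Least_le) blast
    qed
    moreover have "strict_mono (\<lambda>n. r (N + n))"
      using r(1) by (simp add: strict_mono_def)
    ultimately show ?thesis
      using that[of "\<lambda>n. r (N + n)"] by (simp add: mono_def)
  qed
qed

text \<open>Dickson's lemma, by induction on the generators: once the parts in the other generators
  ascend, a further subsequence makes the multiplicity of \<open>g\<close> nondecreasing.\<close>

lemma monoid_span_ascending_subsequence:
  fixes A :: "'a::comm_monoid_add set"
  assumes "finite A" "\<And>n. f n \<in> monoid_span A"
  shows "\<exists>r :: nat \<Rightarrow> nat. strict_mono r \<and>
    (\<forall>i j. i \<le> j \<longrightarrow> (\<exists>s\<in>monoid_span A. f (r j) = f (r i) + s))"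
  using assms
proof (induction A arbitrary: f rule: finite_induct)
  case empty
  have "x = 0" if "x \<in> monoid_span {}" for x :: 'a
    using that by induction auto
  with empty have "f n = 0" for n
    by blast
  then show ?case
    by (intro exI[of _ "\<lambda>n. n"]) (auto simp: strict_mono_def intro: monoid_span.zero)
next
  case (insert g A)
  have "\<forall>n. \<exists>c m. m \<in> monoid_span A \<and> f n = (\<Sum>i<(c::nat). g) + m"
    using insert.prems monoid_span_insert_cases by metis
  then obtain c m where m: "\<And>n. m n \<in> monoid_span A" and f: "\<And>n. f n = (\<Sum>i<(c n::nat). g) + m n"
    by metis
  obtain r :: "nat \<Rightarrow> nat" where r: "strict_mono r"
    "\<forall>i j. i \<le> j \<longrightarrow> (\<exists>s\<in>monoid_span A. m (r j) = m (r i) + s)"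
    using insert.IH[of m, OF m] by (elim exE conjE)
  obtain q :: "nat \<Rightarrow> nat" where q: "strict_mono q" "mono (\<lambda>n. c (r (q n)))"
    by (rule nat_mono_subsequence[of "\<lambda>n. c (r n)"])
  have w: "(\<Sum>i<n. g) \<in> monoid_span (insert g A)" for n :: nat
    by (intro monoid_span_multiple monoid_span.gen) simp
  have "\<exists>s\<in>monoid_span (insert g A). f (r (q j)) = f (r (q i)) + s" if ij: "i \<le> j" for i j
  proof -
    have "q i \<le> q j"
      using monoD[OF strict_mono_mono[OF q(1)] ij] .
    then have "\<exists>s\<in>monoid_span A. m (r (q j)) = m (r (q i)) + s"
      by (rule r(2)[THEN spec, THEN spec, THEN mp])
    then obtain s where s: "s \<in> monoid_span A" "m (r (q j)) = m (r (q i)) + s"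
      by (rule bexE)
    have "c (r (q i)) \<le> c (r (q j))"
      using monoD[OF q(2) ij] .
    then obtain b where b: "c (r (q j)) = c (r (q i)) + b"
      by (auto simp: le_iff_add)
    have "f (r (q j)) = f (r (q i)) + ((\<Sum>i<b. g) + s)"
      unfolding f b s(2) sum_const_lessThan_add by (simp add: ac_simps)
    moreover have "s \<in> monoid_span (insert g A)"
      using s(1) monoid_span_mono[of A "insert g A"] by auto
    then have "(\<Sum>i<b. g) + s \<in> monoid_span (insert g A)"
      by (rule monoid_span.add[OF w])
    ultimately show ?thesis
      by (rule bexI)
  qed
  then show ?case
    using r(1) q(1) by (intro exI[of _ "\<lambda>n. r (q n)"]) (auto simp: strict_mono_def)
qed

text \<open>Without a finite basis one could choose an infinite sequence in which no term is an
  earlier term plus a monoid element; an ascending subsequence contradicts this.\<close>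

lemma monoid_span_finite_basis:
  fixes A :: "'a::comm_monoid_add set"
  assumes "finite A" "X \<subseteq> monoid_span A"
  obtains B where "B \<subseteq> X" "finite B" "\<And>x. x \<in> X \<Longrightarrow> \<exists>b\<in>B. \<exists>s\<in>monoid_span A. x = b + s"
proof (rule ccontr)
  assume "\<not> thesis"
  with that have no: "\<exists>x\<in>X. \<forall>b\<in>B. \<forall>s\<in>monoid_span A. x \<noteq> b + s" if "B \<subseteq> X" "finite B" for B
    using \<open>B \<subseteq> X\<close> \<open>finite B\<close> by metis
  have "\<exists>f. \<forall>n::nat. f n \<in> X \<and> (\<forall>m<n. \<forall>s\<in>monoid_span A. f n \<noteq> f m + s)"
  proof (rule dependent_wellorder_choice)
    fix f :: "nat \<Rightarrow> 'a" and n
    assume "\<And>m. m < n \<Longrightarrow> f m \<in> X \<and> (\<forall>l<m. \<forall>s\<in>monoid_span A. f m \<noteq> f l + s)"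
    then have "f ` {..<n} \<subseteq> X"
      by blast
    from no[OF this] show "\<exists>r. r \<in> X \<and> (\<forall>m<n. \<forall>s\<in>monoid_span A. r \<noteq> f m + s)"
      by blast
  qed auto
  then obtain f where f: "\<And>n::nat. f n \<in> X" "\<And>m n s. m < n \<Longrightarrow> s \<in> monoid_span A \<Longrightarrow> f n \<noteq> f m + s"
    by blast
  have "f n \<in> monoid_span A" for n
    using f(1) assms(2) by blast
  from monoid_span_ascending_subsequence[OF assms(1) this]
  obtain r :: "nat \<Rightarrow> nat" where r: "strict_mono r \<and>
    (\<forall>i j. i \<le> j \<longrightarrow> (\<exists>s\<in>monoid_span A. f (r j) = f (r i) + s))"
    by (rule exE)
  then obtain s where "s \<in> monoid_span A" "f (r 1) = f (r 0) + s"
    by (meson zero_le_one)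
  moreover have "r 0 < r 1"
    using r by (simp add: strict_mono_less)
  ultimately show False
    using f(2) by blast
qed

text \<open>The lexicographic order thus serves as a monomial order on exponents in
  \<open>nat \<times> nat\<close>.\<close>

instance prod :: (ordered_cancel_comm_monoid_add, ordered_cancel_comm_monoid_add)
  ordered_cancel_comm_monoid_add
proof
  fix x y z :: "'a \<times> 'b"
  assume "x \<le> y"
  then show "z + x \<le> z + y"
    by (auto simp: less_eq_prod_def intro: add_strict_left_mono add_left_mono)
qed

section \<open>Leading exponents and reduction\<close>

lemma keys_uminus: "Poly_Mapping.keys (- f :: 'a \<Rightarrow>\<^sub>0 'b::ab_group_add) = Poly_Mapping.keys f"
  by (auto simp: in_keys_iff)

lemma keys_minus_subset:
  "Poly_Mapping.keys (f - g :: 'a \<Rightarrow>\<^sub>0 'b::ab_group_add) \<subseteq> Poly_Mapping.keys f \<union> Poly_Mapping.keys g"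
  by (auto simp: in_keys_iff lookup_minus)

lemma keys_nonempty: "f \<noteq> 0 \<Longrightarrow> Poly_Mapping.keys f \<noteq> {}"
  by (auto simp: in_keys_iff poly_mapping_eq_iff fun_eq_iff)

text \<open>The maximum of the empty set is unspecified, so this is meaningful for nonzero
  \<open>f\<close>.\<close>

definition lead_exp :: "('a::linorder \<Rightarrow>\<^sub>0 'b::zero) \<Rightarrow> 'a" where
  "lead_exp f = Max (Poly_Mapping.keys f)"

lemma lead_exp_in_keys: "f \<noteq> 0 \<Longrightarrow> lead_exp f \<in> Poly_Mapping.keys f"
  unfolding lead_exp_def by (rule Max_in) (auto dest: keys_nonempty)

lemma keys_le_lead_exp: "x \<in> Poly_Mapping.keys f \<Longrightarrow> x \<le> lead_exp f"
  unfolding lead_exp_def by simp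

text \<open>Because \<open>a\<close> and \<open>b\<close> bound the exponents, only the pair
  \<open>(a, b)\<close> contributes to the coefficient at \<open>a + b\<close>.\<close>

lemma lookup_mult_top:
  fixes f g :: "'a::{ordered_cancel_comm_monoid_add, linorder} \<Rightarrow>\<^sub>0 'b::comm_ring_1"
  assumes f: "\<And>x. x \<in> Poly_Mapping.keys f \<Longrightarrow> x \<le> a"
    and g: "\<And>x. x \<in> Poly_Mapping.keys g \<Longrightarrow> x \<le> b"
  shows "Poly_Mapping.lookup (f * g) (a + b) = Poly_Mapping.lookup f a * Poly_Mapping.lookup g b"
proof -
  let ?c = "Poly_Mapping.single a (Poly_Mapping.lookup f a)"
  let ?e = "Poly_Mapping.single b (Poly_Mapping.lookup g b)"
  have f': "x < a" if "x \<in> Poly_Mapping.keys (f - ?c)" for x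
  proof -
    have "x \<noteq> a" "x \<in> Poly_Mapping.keys f"
      using that by (auto simp: in_keys_iff lookup_minus lookup_single when_def split: if_splits)
    then show ?thesis
      using f by force
  qed
  have g': "x < b" if "x \<in> Poly_Mapping.keys (g - ?e)" for x
  proof -
    have "x \<noteq> b" "x \<in> Poly_Mapping.keys g"
      using that by (auto simp: in_keys_iff lookup_minus lookup_single when_def split: if_splits)
    then show ?thesis
      using g by force
  qed
  have "a + b \<notin> Poly_Mapping.keys ((f - ?c) * g)"
  proof
    assume "a + b \<in> Poly_Mapping.keys ((f - ?c) * g)"
    then obtain x y where "a + b = x + y" "x \<in> Poly_Mapping.keys (f - ?c)" "y \<in> Poly_Mapping.keys g"
      using keys_mult by blast
    then show False
      using add_less_le_mono[OF f' g] by (metis less_irrefl)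
  qed
  moreover have "a + b \<notin> Poly_Mapping.keys (?c * (g - ?e))"
  proof
    assume "a + b \<in> Poly_Mapping.keys (?c * (g - ?e))"
    then obtain x y where xy: "a + b = x + y" "x \<in> Poly_Mapping.keys ?c" "y \<in> Poly_Mapping.keys (g - ?e)"
      using keys_mult by blast
    then have "x = a"
      by (simp split: if_splits)
    with xy show False
      using g'[of y] by simp
  qed
  moreover have "f * g = ?c * ?e + ?c * (g - ?e) + (f - ?c) * g"
    by (simp add: algebra_simps)
  ultimately show ?thesis
    by (simp add: lookup_add in_keys_iff mult_single)
qed

lemma lead_exp_mult:
  fixes f g :: "'a::{ordered_cancel_comm_monoid_add, linorder} \<Rightarrow>\<^sub>0 'b::idom"
  assumes "f \<noteq> 0" "g \<noteq> 0"
  shows "lead_exp (f * g) = lead_exp f + lead_exp g"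
  unfolding lead_exp_def[of "f * g"]
proof (rule Max_eqI)
  fix x assume "x \<in> Poly_Mapping.keys (f * g)"
  then obtain y z where "x = y + z" "y \<in> Poly_Mapping.keys f" "z \<in> Poly_Mapping.keys g"
    using keys_mult by blast
  then show "x \<le> lead_exp f + lead_exp g"
    by (simp add: add_mono keys_le_lead_exp)
next
  have "Poly_Mapping.lookup (f * g) (lead_exp f + lead_exp g) \<noteq> 0"
    using lead_exp_in_keys assms
    by (subst lookup_mult_top) (auto simp: keys_le_lead_exp in_keys_iff)
  then show "lead_exp f + lead_exp g \<in> Poly_Mapping.keys (f * g)"
    by (simp add: in_keys_iff)
qed simp

lemma lead_exp_cancel:
  fixes f g :: "'a::linorder \<Rightarrow>\<^sub>0 'b::ab_group_add"
  assumes "lead_exp f = lead_exp g"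
    and "Poly_Mapping.lookup f (lead_exp f) = Poly_Mapping.lookup g (lead_exp f)"
    and "f - g \<noteq> 0"
  shows "lead_exp (f - g) < lead_exp f"
proof -
  have "lead_exp (f - g) \<in> Poly_Mapping.keys (f - g)"
    using lead_exp_in_keys assms(3) .
  then have "lead_exp (f - g) \<noteq> lead_exp f" "lead_exp (f - g) \<le> lead_exp f"
    using assms(1,2) keys_minus_subset[of f g] keys_le_lead_exp[of _ f] keys_le_lead_exp[of _ g]
    by (auto simp: in_keys_iff lookup_minus)
  then show ?thesis
    by simp
qed

lemma semigroup_ring_simps [simp]:
  "carrier (semigroup_ring S) = {f. Poly_Mapping.keys f \<subseteq> S}"
  "f \<otimes>\<^bsub>semigroup_ring S\<^esub> g = f * g" "f \<oplus>\<^bsub>semigroup_ring S\<^esub> g = f + g"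
  "\<one>\<^bsub>semigroup_ring S\<^esub> = 1" "\<zero>\<^bsub>semigroup_ring S\<^esub> = 0"
  by (simp_all add: semigroup_ring_def)

lemma keys_subset_minus:
  "Poly_Mapping.keys (f :: 'a \<Rightarrow>\<^sub>0 'b::ab_group_add) \<subseteq> S \<Longrightarrow> Poly_Mapping.keys g \<subseteq> S \<Longrightarrow>
    Poly_Mapping.keys (f - g) \<subseteq> S"
  using keys_minus_subset[of f g] by blast

lemma keys_subset_plus:
  "Poly_Mapping.keys f \<subseteq> S \<Longrightarrow> Poly_Mapping.keys g \<subseteq> S \<Longrightarrow> Poly_Mapping.keys (f + g) \<subseteq> S"
  using Poly_Mapping.keys_add[of f g] by blast

text \<open>A Groebner basis argument: elements of \<open>I\<close> whose leading exponents form a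
  finite basis of all leading exponents of \<open>I\<close> reduce every element of \<open>I\<close>
  to zero, and the well-order on exponents makes the reduction terminate.\<close>

theorem noetherian_semigroup_ring:
  fixes A :: "'a::{ordered_cancel_comm_monoid_add, wellorder} set"
  assumes "finite A"
  shows "noetherian_ring (semigroup_ring (monoid_span A) :: ('a \<Rightarrow>\<^sub>0 'k::field) ring)"
    (is "noetherian_ring ?R")
proof -
  interpret R: cring ?R
    by (rule cring_semigroup_ring)
  show ?thesis
  proof (rule R.noetherian_ringI)
    fix I assume I: "ideal I ?R"
    interpret I: ideal I ?R by fact
    have carr: "Poly_Mapping.keys f \<subseteq> monoid_span A" if "f \<in> I" for f
      using I.Icarr[OF that] by simp
    let ?X = "lead_exp ` (I - {0})"
    have "?X \<subseteq> monoid_span A"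
      using carr lead_exp_in_keys by blast
    then obtain B where B: "B \<subseteq> ?X" "finite B"
      "\<And>x. x \<in> ?X \<Longrightarrow> \<exists>b\<in>B. \<exists>s\<in>monoid_span A. x = b + s"
      using monoid_span_finite_basis[OF assms, of ?X] by metis
    obtain F where F: "F \<subseteq> I - {0}" "finite F" "B = lead_exp ` F"
      using B(1,2) finite_subset_image by metis
    have FR: "F \<subseteq> carrier ?R"
      using F(1) carr by auto
    interpret J: ideal "genideal ?R F" ?R
      using R.genideal_ideal[OF FR] .
    have "f \<in> genideal ?R F" if "f \<in> I" for f
      using that
    proof (induction "lead_exp f" arbitrary: f rule: less_induct)
      case less
      show ?case
      proof (cases "f = 0")
        case True
        then show ?thesis
          using J.zero_closed by simp
      next
        case False
        then obtain g s where g: "g \<in> F" "s \<in> monoid_span A" "lead_exp f = lead_exp g + s"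
          using B(3)[of "lead_exp f"] less.prems F(3) by blast
        have gI: "g \<in> I" "g \<noteq> 0"
          using F(1) g(1) by auto
        \<comment> \<open>The quotient of leading coefficients, so that \<open>g\<close> times the
          monomial at \<open>s\<close> cancels the leading term of \<open>f\<close>;
          \<open>s \<in> monoid_span A\<close> keeps this multiplier in the ring.\<close>
        define c where "c = Poly_Mapping.lookup f (lead_exp f) / Poly_Mapping.lookup g (lead_exp g)"
        have lf: "Poly_Mapping.lookup f (lead_exp f) \<noteq> 0" "Poly_Mapping.lookup g (lead_exp g) \<noteq> 0"
          using lead_exp_in_keys False gI(2) by (auto simp: in_keys_iff)
        then have c: "c \<noteq> 0"
          unfolding c_def by simp
        let ?t = "Poly_Mapping.single s c"
        have t: "?t \<noteq> 0" "lead_exp ?t = s" "?t \<in> carrier ?R"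
          using c g(2) by (auto simp: lead_exp_def dest: arg_cong[of _ _ Poly_Mapping.keys])
        have lead: "lead_exp f = lead_exp (g * ?t)"
          using lead_exp_mult[OF gI(2) t(1)] t(2) g(3) by simp
        have "Poly_Mapping.lookup (g * ?t) (lead_exp g + s) = Poly_Mapping.lookup g (lead_exp g) * c"
          using c by (subst lookup_mult_top) (auto simp: keys_le_lead_exp)
        then have look: "Poly_Mapping.lookup f (lead_exp f) = Poly_Mapping.lookup (g * ?t) (lead_exp f)"
          using lf g(3) unfolding c_def by simp
        have gt: "g * ?t \<in> genideal ?R F"
          using J.I_r_closed[OF _ t(3)] R.genideal_self[OF FR] g(1) by auto
        have gtI: "g * ?t \<in> I"
          using I.I_r_closed[OF gI(1) t(3)] by simp
        have "- (g * ?t) = (- 1) * (g * ?t)"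
          by simp
        then have "- (g * ?t) \<in> I"
          using I.I_l_closed[OF gtI, of "-1"] by (auto simp: keys_uminus monoid_span.zero)
        then have diff: "f - g * ?t \<in> I"
          using I.a_closed[OF less.prems] by force
        have "f - g * ?t \<in> genideal ?R F"
        proof (cases "f - g * ?t = 0")
          case True
          then show ?thesis
            using J.zero_closed by simp
        next
          case False
          show ?thesis
            using less.hyps[OF lead_exp_cancel[OF lead look False] diff] .
        qed
        then have "f - g * ?t + g * ?t \<in> genideal ?R F"
          using J.a_closed gt by fastforce
        then show ?thesis
          by simp
      qed
    qed
    moreover have "genideal ?R F \<subseteq> I"
      using R.genideal_minimal[OF I] F(1) by blast
    ultimately show "\<exists>A\<subseteq>carrier ?R. finite A \<and> I = genideal ?R A"
      using FR F(2) by blast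
  qed
qed

lemma domain_semigroup_ring:
  "domain (semigroup_ring (monoid_span A) :: ('a::{ordered_cancel_comm_monoid_add, linorder} \<Rightarrow>\<^sub>0 'k::field) ring)"
  by (intro domain.intro cring_semigroup_ring domain_axioms.intro) auto

section \<open>Algebraic dependence and chains of primes\<close>

text \<open>For a family instead of a set: a repeated vector gives a relation at once, and an
  injective family has too many values to be independent.\<close>

lemma (in vector_space) linear_relation_of_card:
  assumes "finite I" "finite T" "f ` I \<subseteq> span T" "card T < card I"
  obtains c i where "i \<in> I" "c i \<noteq> 0" "(\<Sum>i\<in>I. scale (c i) (f i)) = 0"
proof (cases "inj_on f I")
  case True
  then have "\<not> independent (f ` I)"
    using independent_span_bound[OF assms(2) _ assms(3)] assms(4) by (auto simp: card_image)
  then obtain u where "\<exists>v\<in>f ` I. u v \<noteq> 0" "(\<Sum>v\<in>f ` I. scale (u v) v) = 0"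
    using dependent_finite[of "f ` I"] assms(1) by auto
  then show ?thesis
    using that[of _ "\<lambda>i. u (f i)"] True by (auto simp: sum.reindex)
next
  case False
  then obtain i j where ij: "i \<in> I" "j \<in> I" "i \<noteq> j" "f i = f j"
    unfolding inj_on_def by blast
  define c :: "_ \<Rightarrow> 'a" where "c = (\<lambda>x. if x = i then 1 else if x = j then - 1 else 0)"
  have "(\<Sum>x\<in>I. scale (c x) (f x)) = (\<Sum>x\<in>{i, j}. scale (c x) (f x))"
    by (rule sum.mono_neutral_right) (use ij assms(1) in \<open>auto simp: c_def\<close>)
  also have "\<dots> = 0"
    using ij by (simp add: c_def)
  finally show ?thesis
    using that[of i c] ij by (simp add: c_def)
qed

lemma vector_space_poly_mapping:
  "vector_space (\<lambda>c (f :: 'a::comm_monoid_add \<Rightarrow>\<^sub>0 'k::field). Poly_Mapping.single 0 c * f)"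
  by unfold_locales
    (simp_all add: algebra_simps single_add mult.assoc[symmetric] mult_single)

lemma poly_mapping_eq_sum_single:
  "f = (\<Sum>x\<in>Poly_Mapping.keys f. Poly_Mapping.single 0 (Poly_Mapping.lookup f x) * Poly_Mapping.single x 1)"
  for f :: "'a::comm_monoid_add \<Rightarrow>\<^sub>0 'k::field"
  by (rule poly_mapping_eqI)
    (simp add: mult_single lookup_sum lookup_single when_def sum.delta in_keys_iff)

text \<open>The \<open>N\<^sup>3\<close> monomials with exponents below \<open>N\<close> live in a space of dimension \<open>O(N\<^sup>2)\<close>.\<close>
lemma algebraically_dependent_three:
  fixes f0 f1 f2 :: "nat \<times> nat \<Rightarrow>\<^sub>0 'k::field"
  obtains N c where "\<exists>a<N. \<exists>b<N. \<exists>e<N. c a b e \<noteq> 0"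
    "(\<Sum>a<N. f0 ^ a * (\<Sum>b<N. f1 ^ b * (\<Sum>e<N. f2 ^ e * Poly_Mapping.single 0 (c a b e)))) = 0"
proof -
  define box :: "nat \<Rightarrow> (nat \<times> nat) set" where "box B = {..B} \<times> {..B}" for B
  have box_mult: "Poly_Mapping.keys (f * g) \<subseteq> box (A + B)"
    if "Poly_Mapping.keys f \<subseteq> box A" "Poly_Mapping.keys g \<subseteq> box B"
    for f g :: "nat \<times> nat \<Rightarrow>\<^sub>0 'k" and A B
  proof -
    have "x + y \<in> box (A + B)" if "x \<in> box A" "y \<in> box B" for x y
      using that unfolding box_def by (auto simp: mem_Times_iff)
    then show ?thesis
      using keys_mult[of f g] that by blast
  qed
  have box_pow: "Poly_Mapping.keys (f ^ n) \<subseteq> box (n * A)"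
    if "Poly_Mapping.keys f \<subseteq> box A" for f :: "nat \<times> nat \<Rightarrow>\<^sub>0 'k" and A n
  proof (induction n)
    case (Suc n)
    then show ?case
      using box_mult[OF that Suc] by simp
  qed (auto simp: box_def zero_prod_def)
  define K where "K = Poly_Mapping.keys f0 \<union> Poly_Mapping.keys f1 \<union> Poly_Mapping.keys f2"
  \<comment> \<open>A crude bound for both coordinates of every exponent that occurs.\<close>
  define D where "D = (\<Sum>x\<in>K. fst x + snd x)"
  have K: "K \<subseteq> box D"
  proof
    fix x assume "x \<in> K"
    then have "fst x + snd x \<le> D"
      unfolding D_def by (intro member_le_sum) (auto simp: K_def)
    then show "x \<in> box D"
      unfolding box_def by (auto simp: mem_Times_iff)
  qed
  \<comment> \<open>Chosen so that \<open>(3 * D + 1)\<^sup>2 < N\<close>: then \<open>(3 * N * D +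
    1)\<^sup>2 \<le> N\<^sup>2 * (3 * D + 1)\<^sup>2 < N\<^sup>2 * N\<close>, so the box has fewer
    monomials than there are products.\<close>
  define N where "N = (3 * D + 1)\<^sup>2 + 1"
  define I where "I = {..<N} \<times> {..<N} \<times> {..<N}"
  define f where "f = (\<lambda>(a, b, e). f0 ^ a * (f1 ^ b * f2 ^ e))"
  define T where "T = (\<lambda>x. Poly_Mapping.single x (1::'k)) ` box (3 * N * D)"
  interpret vs: vector_space "\<lambda>c (f :: nat \<times> nat \<Rightarrow>\<^sub>0 'k). Poly_Mapping.single 0 c * f"
    by (rule vector_space_poly_mapping)
  have span: "g \<in> vs.span T" if "Poly_Mapping.keys g \<subseteq> box (3 * N * D)" for g
    by (subst poly_mapping_eq_sum_single)
      (intro vs.span_sum vs.span_scale vs.span_base, use that in \<open>auto simp: T_def\<close>)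
  have "f i \<in> vs.span T" if i: "i \<in> I" for i
  proof -
    obtain a b e where abe: "i = (a, b, e)" "a < N" "b < N" "e < N"
      using i unfolding I_def by auto
    have "Poly_Mapping.keys (f i) \<subseteq> box (a * D + (b * D + e * D))"
      unfolding abe f_def prod.case
      by (intro box_mult box_pow) (use K in \<open>auto simp: K_def\<close>)
    moreover have "a * D + (b * D + e * D) \<le> N * D + (N * D + N * D)"
      using abe by (intro add_mono mult_right_mono) auto
    then have "box (a * D + (b * D + e * D)) \<subseteq> box (3 * N * D)"
      unfolding box_def by (intro Sigma_mono) auto
    ultimately show ?thesis
      by (intro span) blast
  qed
  then have "f ` I \<subseteq> vs.span T"
    by blast
  moreover have "card T < card I"
  proof -
    have "card T \<le> card (box (3 * N * D))"
      unfolding T_def by (rule card_image_le) (simp add: box_def)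
    also have "\<dots> = (3 * N * D + 1)\<^sup>2"
      by (simp add: box_def power2_eq_square)
    also have "\<dots> \<le> (N * (3 * D + 1))\<^sup>2"
      by (intro power_mono) (auto simp: N_def algebra_simps)
    also have "\<dots> < N\<^sup>2 * N"
      unfolding power_mult_distrib by (intro mult_strict_left_mono) (auto simp: N_def)
    also have "\<dots> = card I"
      by (simp add: I_def power2_eq_square)
    finally show ?thesis .
  qed
  moreover have fin: "finite I" "finite T"
    by (simp_all add: I_def T_def box_def)
  ultimately obtain c i where c: "i \<in> I" "c i \<noteq> 0"
    "(\<Sum>i\<in>I. Poly_Mapping.single 0 (c i) * f i) = 0"
    using vs.linear_relation_of_card[OF fin] by blast
  define c' where "c' a b e = c (a, b, e)" for a b e
  have "(\<Sum>i\<in>I. Poly_Mapping.single 0 (c i) * f i) =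
      (\<Sum>(a, b, e)\<in>I. f0 ^ a * (f1 ^ b * (f2 ^ e * Poly_Mapping.single 0 (c' a b e))))"
    by (rule sum.cong) (auto simp: f_def c'_def ac_simps)
  also have "\<dots> = (\<Sum>a<N. f0 ^ a * (\<Sum>b<N. f1 ^ b * (\<Sum>e<N. f2 ^ e * Poly_Mapping.single 0 (c' a b e))))"
    unfolding I_def sum_distrib_left sum.cartesian_product
    by (simp add: case_prod_beta)
  finally have "(\<Sum>a<N. f0 ^ a * (\<Sum>b<N. f1 ^ b * (\<Sum>e<N. f2 ^ e * Poly_Mapping.single 0 (c' a b e)))) = 0"
    using c(3) by simp
  moreover have "\<exists>a<N. \<exists>b<N. \<exists>e<N. c' a b e \<noteq> 0"
    using c(1,2) unfolding I_def c'_def by (cases i) auto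
  ultimately show ?thesis
    by (rule that[rotated])
qed

section \<open>Polynomial relations modulo primes\<close>

lemma semigroup_ring_mult_closed:
  fixes f g :: "'a::comm_monoid_add \<Rightarrow>\<^sub>0 'k::field"
  assumes "f \<in> carrier (semigroup_ring (monoid_span A))" "g \<in> carrier (semigroup_ring (monoid_span A))"
  shows "f * g \<in> carrier (semigroup_ring (monoid_span A))"
  using monoid_span_keys_mult[of f A g] assms by simp

lemma semigroup_ring_power_closed:
  fixes f :: "'a::comm_monoid_add \<Rightarrow>\<^sub>0 'k::field"
  assumes "f \<in> carrier (semigroup_ring (monoid_span A))"
  shows "f ^ n \<in> carrier (semigroup_ring (monoid_span A))"
proof (induction n)
  case (Suc n)
  then show ?case
    using semigroup_ring_mult_closed[OF assms Suc] by simp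
qed (simp add: monoid_span.zero)

lemma semigroup_ring_sum_closed:
  assumes "\<And>j. j \<in> J \<Longrightarrow> f j \<in> carrier (semigroup_ring S)"
  shows "sum f J \<in> carrier (semigroup_ring S)"
  using Poly_Mapping.keys_sum[of f J] assms by fastforce

lemma semigroup_ring_ideal_closed:
  fixes Q :: "('a::comm_monoid_add \<Rightarrow>\<^sub>0 'k::field) set"
  assumes "ideal Q (semigroup_ring (monoid_span A))"
  shows "0 \<in> Q" "f \<in> Q \<Longrightarrow> g \<in> Q \<Longrightarrow> f + g \<in> Q"
    "f \<in> carrier (semigroup_ring (monoid_span A)) \<Longrightarrow> g \<in> Q \<Longrightarrow> f * g \<in> Q"
    "f \<in> Q \<Longrightarrow> - f \<in> Q" "f \<in> Q \<Longrightarrow> g \<in> Q \<Longrightarrow> f - g \<in> Q"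
proof -
  note sub = ideal.axioms(1)[OF assms]
  show "0 \<in> Q"
    using additive_subgroup.zero_closed[OF sub] by (simp only: semigroup_ring_simps)
  show add: "f + g \<in> Q" if "f \<in> Q" "g \<in> Q" for f g
    using additive_subgroup.a_closed[OF sub that] by (simp only: semigroup_ring_simps)
  show mul: "f * g \<in> Q" if "f \<in> carrier (semigroup_ring (monoid_span A))" "g \<in> Q" for f g
    using ideal.I_l_closed[OF assms that(2,1)] by (simp only: semigroup_ring_simps)
  show neg: "- f \<in> Q" if "f \<in> Q" for f
    using mul[OF _ that, of "- 1"] by (simp add: keys_uminus monoid_span.zero)
  show "f - g \<in> Q" if "f \<in> Q" "g \<in> Q" for f g
    using add[OF that(1) neg[OF that(2)]] by simp
qed

lemma single_in_semigroup_ring: "s \<in> S \<Longrightarrow> Poly_Mapping.single s c \<in> carrier (semigroup_ring S)"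
  by simp

text \<open>If \<open>m = 0\<close>, all other terms are multiples of \<open>x \<in> Q\<close>.
  Otherwise the whole sum is a multiple of \<open>x\<close>; as \<open>P\<close> is prime and
  \<open>x \<notin> P\<close>, this factor can be removed, which shifts \<open>g\<close> by
  one.\<close>

lemma lowest_coeff_in_prime:
  fixes P Q :: "('a::comm_monoid_add \<Rightarrow>\<^sub>0 'k::field) set"
  assumes "primeideal P (semigroup_ring (monoid_span A))" "ideal Q (semigroup_ring (monoid_span A))"
    and "P \<subseteq> Q" "x \<in> Q" "x \<notin> P"
    and "\<And>j. g j \<in> carrier (semigroup_ring (monoid_span A))"
    and "(\<Sum>j<N. x ^ j * g j) \<in> P" "m < N" "\<And>j. j < m \<Longrightarrow> g j = 0"
  shows "g m \<in> Q"
  using assms(6-)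
proof (induction m arbitrary: g N)
  case (0 g N)
  interpret Q: ideal Q "semigroup_ring (monoid_span A)" by fact
  have x: "x \<in> carrier (semigroup_ring (monoid_span A))"
    using Q.Icarr assms(4) .
  obtain M where N: "N = Suc M"
    using 0 by (cases N) auto
  let ?r = "\<Sum>j<M. x ^ j * g (Suc j)"
  have sum: "(\<Sum>j<N. x ^ j * g j) = g 0 + x * ?r"
    unfolding N sum.lessThan_Suc_shift by (simp add: sum_distrib_left mult.assoc)
  have "?r \<in> carrier (semigroup_ring (monoid_span A))"
    using 0(1) x by (intro semigroup_ring_mult_closed semigroup_ring_sum_closed semigroup_ring_power_closed)
  then have "?r * x \<in> Q"
    using semigroup_ring_ideal_closed(3)[OF assms(2) _ assms(4)] by blast
  then have "x * ?r \<in> Q"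
    by (simp add: mult.commute)
  moreover have "g 0 + x * ?r \<in> Q"
    using 0(2) assms(3) sum by auto
  ultimately have "(g 0 + x * ?r) - x * ?r \<in> Q"
    using semigroup_ring_ideal_closed(5)[OF assms(2)] by blast
  then show ?case
    by simp
next
  case (Suc m g N)
  interpret P: primeideal P "semigroup_ring (monoid_span A)" by fact
  interpret Q: ideal Q "semigroup_ring (monoid_span A)" by fact
  have x: "x \<in> carrier (semigroup_ring (monoid_span A))"
    using Q.Icarr assms(4) .
  obtain M where N: "N = Suc M" "m < M"
    using Suc.prems(3) by (cases N) auto
  let ?r = "\<Sum>j<M. x ^ j * g (Suc j)"
  have "(\<Sum>j<N. x ^ j * g j) = x * ?r"
    using Suc.prems(4)[of 0] unfolding N sum.lessThan_Suc_shift
    by (simp add: sum_distrib_left mult.assoc)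
  then have "x * ?r \<in> P"
    using Suc.prems(2) by simp
  moreover have "?r \<in> carrier (semigroup_ring (monoid_span A))"
    using Suc.prems(1) x by (intro semigroup_ring_mult_closed semigroup_ring_sum_closed semigroup_ring_power_closed) auto
  ultimately have "?r \<in> P"
    using P.I_prime[OF x, of ?r] assms(5) by simp
  then show ?case
    using Suc.IH[of "\<lambda>j. g (Suc j)" M] Suc.prems N(2) by auto
qed

text \<open>Take \<open>x\<^sub>0 \<in> P\<^sub>1 - P\<^sub>0\<close> and \<open>x\<^sub>1 \<in> P\<^sub>2 - P\<^sub>1\<close>. In a polynomial relation between
  \<open>x\<^sub>0, x\<^sub>1, w\<close>, stripping the lowest power of \<open>x\<^sub>0\<close> modulo \<open>P\<^sub>0\<close> and then that of \<open>x\<^sub>1\<close> modulo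
  \<open>P\<^sub>1\<close> leaves a relation for \<open>w\<close> alone modulo \<open>P\<^sub>2\<close>. This replaces both the Nullstellensatz and
  dimension theory.\<close>
lemma algebraic_modulo_chain:
  fixes P0 P1 P2 :: "(nat \<times> nat \<Rightarrow>\<^sub>0 'k::field) set"
  assumes P: "primeideal P0 (semigroup_ring (monoid_span A))" "primeideal P1 (semigroup_ring (monoid_span A))"
      "primeideal P2 (semigroup_ring (monoid_span A))"
    and "P0 \<subset> P1" "P1 \<subset> P2" and w: "w \<in> carrier (semigroup_ring (monoid_span A))"
  obtains N k n where "n < N" "k n \<noteq> 0" "(\<Sum>j<N. w ^ j * Poly_Mapping.single 0 (k j)) \<in> P2"
proof -
  let ?R = "semigroup_ring (monoid_span A) :: (nat \<times> nat \<Rightarrow>\<^sub>0 'k) ring"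
  interpret P0: primeideal P0 ?R by fact
  interpret P1: primeideal P1 ?R by fact
  interpret P2: primeideal P2 ?R by fact
  obtain x0 x1 where x: "x0 \<in> P1" "x0 \<notin> P0" "x1 \<in> P2" "x1 \<notin> P1"
    using assms(4,5) by blast
  have xR: "x0 \<in> carrier ?R" "x1 \<in> carrier ?R"
    using x P1.Icarr P2.Icarr by blast+
  obtain N c where nz: "\<exists>a<N. \<exists>b<N. \<exists>e<N. c a b e \<noteq> 0"
    and rel: "(\<Sum>a<N. x0 ^ a * (\<Sum>b<N. x1 ^ b * (\<Sum>e<N. w ^ e * Poly_Mapping.single 0 (c a b e)))) = 0"
    by (rule algebraically_dependent_three)
  define h where "h a b = (\<Sum>e<N. w ^ e * Poly_Mapping.single 0 (if e < N then c a b e else 0))" for a b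
  have hR: "h a b \<in> carrier ?R" for a b
    unfolding h_def using w
    by (intro semigroup_ring_sum_closed semigroup_ring_mult_closed semigroup_ring_power_closed single_in_semigroup_ring)
      (auto simp: monoid_span.zero)
  have gR: "(\<Sum>b<N. x1 ^ b * h a b) \<in> carrier ?R" for a
    using xR hR by (intro semigroup_ring_sum_closed semigroup_ring_mult_closed semigroup_ring_power_closed) auto
  have relP: "(\<Sum>a<N. x0 ^ a * (\<Sum>b<N. x1 ^ b * h a b)) \<in> P0"
    using rel semigroup_ring_ideal_closed(1)[OF P0.is_ideal] by (simp add: h_def)
  define nz1 where "nz1 a \<longleftrightarrow> a < N \<and> (\<exists>b<N. \<exists>e<N. c a b e \<noteq> 0)" for a
  \<comment> \<open>The least power of \<open>x0\<close> whose coefficient involves a nonzero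
    scalar; all lower coefficients vanish, as stripping powers of \<open>x0\<close>
    requires.\<close>
  define m where "m = (LEAST a. nz1 a)"
  have "\<exists>a. nz1 a"
    using nz unfolding nz1_def by blast
  then have m: "nz1 m"
    unfolding m_def by (rule LeastI_ex)
  have g0: "(\<Sum>b<N. x1 ^ b * h a b) = 0" if "a < m" for a
  proof -
    have "a < N" "\<not> nz1 a"
      using that not_less_Least[of a nz1] m unfolding m_def nz1_def by auto
    then show ?thesis
      unfolding nz1_def h_def by simp
  qed
  have "(\<Sum>b<N. x1 ^ b * h m b) \<in> P1"
    by (rule lowest_coeff_in_prime[OF P(1) P1.is_ideal _ x(1,2), of "\<lambda>a. \<Sum>b<N. x1 ^ b * h a b" N m])
      (use assms(4) gR relP m g0 in \<open>simp_all add: nz1_def psubset_imp_subset\<close>)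
  moreover define nz2 where "nz2 b \<longleftrightarrow> b < N \<and> (\<exists>e<N. c m b e \<noteq> 0)" for b
  define n where "n = (LEAST b. nz2 b)"
  have "\<exists>b. nz2 b"
    using m unfolding nz1_def nz2_def by blast
  then have n: "nz2 n"
    unfolding n_def by (rule LeastI_ex)
  have h0: "h m b = 0" if "b < n" for b
  proof -
    have "b < N" "\<not> nz2 b"
      using that not_less_Least[of b nz2] n unfolding n_def nz2_def by auto
    then show ?thesis
      unfolding nz2_def h_def by simp
  qed
  ultimately have "h m n \<in> P2"
    by (intro lowest_coeff_in_prime[OF P(2) P2.is_ideal _ x(3,4), of "h m" N n])
      (use assms(5) hR n h0 in \<open>simp_all add: nz2_def psubset_imp_subset\<close>)
  moreover obtain e where "e < N" "c m n e \<noteq> 0"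
    using n unfolding nz2_def by blast
  ultimately show ?thesis
    using that[of e N "c m n"] by (simp add: h_def)
qed

text \<open>An element \<open>w\<close> of \<open>P3 - P2\<close> satisfies a nontrivial relation
  modulo \<open>P2\<close>; stripping powers of \<open>w\<close> leaves a nonzero constant, hence a
  unit, in \<open>P3\<close>.\<close>

lemma no_prime_chain_of_length_three:
  fixes P0 P1 P2 P3 :: "(nat \<times> nat \<Rightarrow>\<^sub>0 'k::field) set"
  assumes "primeideal P0 (semigroup_ring (monoid_span A))" "primeideal P1 (semigroup_ring (monoid_span A))"
      "primeideal P2 (semigroup_ring (monoid_span A))" "primeideal P3 (semigroup_ring (monoid_span A))"
    and "P0 \<subset> P1" "P1 \<subset> P2" "P2 \<subset> P3"
  shows False
proof -
  let ?R = "semigroup_ring (monoid_span A) :: (nat \<times> nat \<Rightarrow>\<^sub>0 'k) ring"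
  interpret P3: primeideal P3 ?R by fact
  obtain w where w: "w \<in> P3" "w \<notin> P2"
    using assms(7) by blast
  obtain N k n where k: "n < N" "k n \<noteq> 0" "(\<Sum>j<N. w ^ j * Poly_Mapping.single 0 (k j)) \<in> P2"
    by (rule algebraic_modulo_chain[OF assms(1-3,5,6) P3.Icarr[OF w(1)]])
  define m where "m = (LEAST j. k j \<noteq> 0)"
  have m: "m < N" "k m \<noteq> 0"
    using LeastI[of "\<lambda>j. k j \<noteq> 0", OF k(2)] Least_le[of "\<lambda>j. k j \<noteq> 0", OF k(2)] k(1)
    unfolding m_def by simp_all
  have m_least: "Poly_Mapping.single 0 (k j) = 0" if "j < m" for j
    using not_less_Least[of j "\<lambda>j. k j \<noteq> 0"] that unfolding m_def by simp
  have single: "Poly_Mapping.single 0 v \<in> carrier ?R" for v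
    by (simp add: monoid_span.zero)
  have "Poly_Mapping.single 0 (k m) \<in> P3"
    by (rule lowest_coeff_in_prime[OF assms(3) P3.is_ideal psubset_imp_subset[OF assms(7)] w single k(3)
          m(1) m_least])
  with single have "Poly_Mapping.single 0 (inverse (k m)) * Poly_Mapping.single 0 (k m) \<in> P3"
    by (rule semigroup_ring_ideal_closed(3)[OF P3.is_ideal])
  then have "\<one>\<^bsub>?R\<^esub> \<in> P3"
    using m(2) by (simp add: mult_single)
  then show False
    using P3.one_imp_carrier P3.I_notcarr by blast
qed

text \<open>The assumption makes \<open>F\<close> a face: a sum lies in it exactly when both
  summands do. Modulo the ideal, only terms with exponents in \<open>F\<close> survive, and they
  multiply as in a domain.\<close>

lemma primeideal_face:
  fixes F :: "'a::{ordered_cancel_comm_monoid_add, linorder} set"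
  assumes F: "\<And>x y. x + y \<in> F \<longleftrightarrow> x \<in> F \<and> y \<in> F" and "0 \<in> F"
  shows "primeideal {f. Poly_Mapping.keys f \<subseteq> monoid_span A - F}
    (semigroup_ring (monoid_span A) :: ('a \<Rightarrow>\<^sub>0 'k::field) ring)" (is "primeideal ?P ?R")
proof -
  interpret R: cring ?R
    by (rule cring_semigroup_ring)
  have lmul: "f * g \<in> ?P" if f: "f \<in> carrier ?R" and g: "g \<in> ?P" for f g
  proof
    have "f * g \<in> carrier ?R"
      using g by (intro semigroup_ring_mult_closed f) auto
    moreover have "x \<notin> F" if x: "x \<in> Poly_Mapping.keys (f * g)" for x
    proof -
      obtain y z where "x = y + z" "z \<in> Poly_Mapping.keys g"
        using x keys_mult[of f g] by blast
      then show ?thesis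
        using F g by auto
    qed
    ultimately show "Poly_Mapping.keys (f * g) \<subseteq> monoid_span A - F"
      by auto
  qed
  have "ideal ?P ?R"
  proof (rule idealI[OF R.ring_axioms])
    show "subgroup ?P (add_monoid ?R)"
    proof (rule R.add.subgroupI)
      show "?P \<subseteq> carrier ?R" "?P \<noteq> {}"
        by (auto intro: exI[of _ 0])
      show "a \<oplus>\<^bsub>?R\<^esub> b \<in> ?P" if "a \<in> ?P" "b \<in> ?P" for a b
        using that keys_subset_plus[of a _ b] by simp
      show "\<ominus>\<^bsub>?R\<^esub> a \<in> ?P" if "a \<in> ?P" for a
      proof -
        have "a \<in> carrier ?R"
          using that by auto
        moreover have "- a \<in> carrier ?R" "- a \<oplus>\<^bsub>?R\<^esub> a = \<zero>\<^bsub>?R\<^esub>"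
          using that by (auto simp: keys_uminus)
        ultimately have "\<ominus>\<^bsub>?R\<^esub> a = - a"
          using R.minus_equality by blast
        then show ?thesis
          using that by (simp add: keys_uminus)
      qed
    qed
    show "f \<otimes>\<^bsub>?R\<^esub> g \<in> ?P" if "g \<in> ?P" "f \<in> carrier ?R" for f g
      using lmul that by simp
    show "g \<otimes>\<^bsub>?R\<^esub> f \<in> ?P" if "g \<in> ?P" "f \<in> carrier ?R" for f g
      using lmul[OF that(2,1)] by (simp add: mult.commute)
  qed
  then show ?thesis
  proof (rule primeidealI[OF _ R.is_cring])
    have "(1 :: 'a \<Rightarrow>\<^sub>0 'k) \<notin> ?P"
      using assms(2) by simp
    moreover have "1 \<in> carrier ?R"
      by (simp add: monoid_span.zero)
    ultimately show "carrier ?R \<noteq> ?P"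
      by blast
    fix f g :: "'a \<Rightarrow>\<^sub>0 'k"
    assume f: "f \<in> carrier ?R" and g: "g \<in> carrier ?R" and fg: "f \<otimes>\<^bsub>?R\<^esub> g \<in> ?P"
    \<comment> \<open>The part of \<open>f\<close> supported on \<open>F\<close>. In a product of
      two elements, only the product of these parts contributes exponents in
      \<open>F\<close>.\<close>
    have split: "\<exists>h. Poly_Mapping.keys h = Poly_Mapping.keys f \<inter> F \<and>
        Poly_Mapping.keys (f - h) \<inter> F = {}" for f :: "'a \<Rightarrow>\<^sub>0 'k"
    proof -
      let ?h = "Poly_Mapping.mapp (\<lambda>x v. if x \<in> F then v else 0) f"
      have "Poly_Mapping.lookup ?h x = (if x \<in> F then Poly_Mapping.lookup f x else 0)" for x
        by (auto simp: lookup_mapp when_def in_keys_iff)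
      then show ?thesis
        by (intro exI[of _ ?h]) (auto simp: in_keys_iff lookup_minus split: if_splits)
    qed
    obtain h where h: "Poly_Mapping.keys h = Poly_Mapping.keys f \<inter> F" "Poly_Mapping.keys (f - h) \<inter> F = {}"
      using split by blast
    obtain l where l: "Poly_Mapping.keys l = Poly_Mapping.keys g \<inter> F" "Poly_Mapping.keys (g - l) \<inter> F = {}"
      using split by blast
    show "f \<in> ?P \<or> g \<in> ?P"
    proof (rule ccontr)
      assume "\<not> ?thesis"
      then have "Poly_Mapping.keys h \<noteq> {}" "Poly_Mapping.keys l \<noteq> {}"
        using f g h(1) l(1) by auto
      then have "h * l \<noteq> 0"
        by auto
      then obtain x where x: "x \<in> Poly_Mapping.keys (h * l)"
        using keys_nonempty by blast
      then obtain y z where "x = y + z" "y \<in> F" "z \<in> F"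
        using keys_mult[of h l] h(1) l(1) by blast
      then have "x \<in> F"
        using F by simp
      have "x \<notin> Poly_Mapping.keys ((f - h) * g)"
      proof
        assume "x \<in> Poly_Mapping.keys ((f - h) * g)"
        then obtain y z where "x = y + z" "y \<in> Poly_Mapping.keys (f - h)"
          using keys_mult[of "f - h" g] by blast
        then show False
          using \<open>x \<in> F\<close> F h(2) by blast
      qed
      moreover have "x \<notin> Poly_Mapping.keys (h * (g - l))"
      proof
        assume "x \<in> Poly_Mapping.keys (h * (g - l))"
        then obtain y z where "x = y + z" "z \<in> Poly_Mapping.keys (g - l)"
          using keys_mult[of h "g - l"] by blast
        then show False
          using \<open>x \<in> F\<close> F l(2) by blast
      qed
      ultimately have "Poly_Mapping.lookup ((f - h) * g) x = 0" "Poly_Mapping.lookup (h * (g - l)) x = 0"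
        using \<open>x \<in> F\<close> by (auto simp: in_keys_iff)
      moreover have "f * g = h * l + (f - h) * g + h * (g - l)"
        by (simp add: algebra_simps)
      ultimately have "Poly_Mapping.lookup (f * g) x = Poly_Mapping.lookup (h * l) x"
        by (simp add: lookup_add)
      then have "x \<in> Poly_Mapping.keys (f * g)"
        using x by (simp add: in_keys_iff)
      then show False
        using fg \<open>x \<in> F\<close> by auto
    qed
  qed
qed

section \<open>Cohen--Macaulay semigroup rings in dimension two\<close>

text \<open>Abstract form of the iterated descent, applied both to exponents in \<open>S\<close> and
  to pairs of a number and the order of a sumset.\<close>

lemma both_directions_iterate:
  assumes "\<And>x. s (t x) = t (s x)"
    and "\<And>x. P x \<Longrightarrow> P (s x)" "\<And>x. P x \<Longrightarrow> P (t x)"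
    and descend: "\<And>x. P (s x) \<Longrightarrow> P (t x) \<Longrightarrow> P x"
    and "P ((s ^^ m) x)" "P ((t ^^ n) x)"
  shows "P x"
proof -
  have comm: "s ((t ^^ n) x) = (t ^^ n) (s x)" for n x
    by (induction n) (simp_all add: assms(1))
  have t: "P ((t ^^ n) x)" if "P x" for n x
    using that by (induction n) (simp_all add: assms(3))
  have s: "P ((s ^^ n) x)" if "P x" for n x
    using that by (induction n) (simp_all add: assms(2))
  have comm': "(t ^^ n) ((s ^^ m) x) = (s ^^ m) ((t ^^ n) x)" for m n x
    by (induction m) (simp_all add: comm[symmetric])
  \<comment> \<open>For a single \<open>s\<close>-step, the \<open>t\<close>-steps are removed one
    at a time: \<open>P (s x)\<close> propagates along \<open>t\<close>, so each intermediate point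
    has both neighbours available.\<close>
  have one: "P x" if "P (s x)" "P ((t ^^ n) x)" for n x
    using that(2)
  proof (induction n)
    case (Suc n)
    have "P (s ((t ^^ n) x))"
      unfolding comm using t[OF that(1)] .
    then show ?case
      using Suc descend by simp
  qed simp
  show ?thesis
    using assms(5)
  proof (induction m)
    case (Suc m)
    have "P ((t ^^ n) ((s ^^ m) x))"
      unfolding comm' using s[OF assms(6)] .
    then have "P ((s ^^ m) x)"
      using one Suc.prems by simp
    then show ?case
      by (rule Suc.IH)
  qed simp
qed

text \<open>Passing to leading exponents in \<open>q y = p z\<close> yields an exponent \<open>w\<close> with \<open>w + (n d, 0) \<in> S\<close>
  and \<open>w + (0, m d) \<in> S\<close>; by assumption \<open>w \<in> S\<close>, so a multiple of \<open>p\<close> inside the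
  ring cancels the leading term of \<open>y\<close>.\<close>
lemma regular_pair_semigroup_ring:
  fixes p q y z :: "nat \<times> nat \<Rightarrow>\<^sub>0 'k::field" and A :: "(nat \<times> nat) set"
  assumes S: "(d, 0) \<in> monoid_span A" "(0, d) \<in> monoid_span A"
    and descend: "\<And>x. x + (d, 0) \<in> monoid_span A \<Longrightarrow> x + (0, d) \<in> monoid_span A \<Longrightarrow> x \<in> monoid_span A"
    and p: "p \<noteq> 0" "Poly_Mapping.keys p \<subseteq> range (\<lambda>n. (n * d, 0))" "p \<in> carrier (semigroup_ring (monoid_span A))"
    and q: "q \<noteq> 0" "Poly_Mapping.keys q \<subseteq> range (\<lambda>n. (0, n * d))" "q \<in> carrier (semigroup_ring (monoid_span A))"
    and "y \<in> carrier (semigroup_ring (monoid_span A))" "z \<in> carrier (semigroup_ring (monoid_span A))"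
      "q * y = p * z"
  shows "\<exists>w\<in>carrier (semigroup_ring (monoid_span A)). y = p * w"
  using assms(10-)
proof (induction "lead_exp y" arbitrary: y z rule: less_induct)
  case less
  let ?C = "carrier (semigroup_ring (monoid_span A)) :: (nat \<times> nat \<Rightarrow>\<^sub>0 'k) set"
  have zero: "(0 :: nat \<times> nat \<Rightarrow>\<^sub>0 'k) \<in> ?C"
    by simp
  show ?case
  proof (cases "y = 0")
    case True
    then show ?thesis
      using zero by (intro bexI[of _ 0]) auto
  next
    case False
    then have "z \<noteq> 0"
      using less.prems(3) q(1) by auto
    obtain n where n: "lead_exp p = (n * d, 0)"
      using lead_exp_in_keys[OF p(1)] p(2) by blast
    obtain m where m: "lead_exp q = (0, m * d)"
      using lead_exp_in_keys[OF q(1)] q(2) by blast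
    have lead: "(0, m * d) + lead_exp y = (n * d, 0) + lead_exp z"
      using lead_exp_mult[OF q(1) False] lead_exp_mult[OF p(1) \<open>z \<noteq> 0\<close>] less.prems(3) n m by simp
    \<comment> \<open>Comparing coordinates in \<open>lead\<close>, this is the common lower corner
      of the two leading exponents: \<open>lead_exp y\<close> lies \<open>n * d\<close> to its right
      and \<open>lead_exp z\<close> lies \<open>m * d\<close> above it.\<close>
    define w where "w = (fst (lead_exp z), snd (lead_exp y))"
    have w: "w + (n * d, 0) = lead_exp y" "w + (0, m * d) = lead_exp z"
      using lead unfolding w_def by (auto simp: prod_eq_iff)
    have in_S: "lead_exp y \<in> monoid_span A" "lead_exp z \<in> monoid_span A"
      using lead_exp_in_keys[OF False] lead_exp_in_keys[OF \<open>z \<noteq> 0\<close>] less.prems(1,2) by auto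
    have iter: "((\<lambda>x. x + (d, 0)) ^^ j) x = x + (j * d, 0)" "((\<lambda>x. x + (0, d)) ^^ j) x = x + (0, j * d)"
      for j and x :: "nat \<times> nat"
      by (induction j) (simp_all add: prod_eq_iff)
    have "w \<in> monoid_span A"
      by (rule both_directions_iterate[of "\<lambda>x. x + (d, 0)" "\<lambda>x. x + (0, d)" "\<lambda>x. x \<in> monoid_span A" n _ m])
        (use descend S w in_S in \<open>auto simp: iter ac_simps intro: monoid_span.add\<close>)
    define c where "c = Poly_Mapping.lookup y (lead_exp y) / Poly_Mapping.lookup p (lead_exp p)"
    have lookup: "Poly_Mapping.lookup y (lead_exp y) \<noteq> 0" "Poly_Mapping.lookup p (lead_exp p) \<noteq> 0"
      using lead_exp_in_keys False p(1) by (auto simp: in_keys_iff)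
    define t where "t = Poly_Mapping.single w c"
    have keys_t: "Poly_Mapping.keys t = {w}"
      using lookup unfolding t_def c_def by simp
    then have t: "t \<noteq> 0" "lead_exp t = w" "t \<in> ?C"
      using \<open>w \<in> monoid_span A\<close> by (auto simp: lead_exp_def)
    have pt: "p * t \<in> ?C" and qt: "q * t \<in> ?C"
      using p(3) q(3) t(3) by (auto intro!: semigroup_ring_mult_closed simp del: semigroup_ring_simps)
    have y': "y - p * t \<in> ?C" and z': "z - q * t \<in> ?C"
      using pt qt less.prems(1,2) keys_subset_minus[of y _ "p * t"] keys_subset_minus[of z _ "q * t"]
      by simp_all
    have lead_pt: "lead_exp y = lead_exp (p * t)"
      using lead_exp_mult[OF p(1) t(1)] t(2) n w(1) by (simp add: add.commute)
    have "Poly_Mapping.lookup (p * t) (lead_exp p + w) = Poly_Mapping.lookup p (lead_exp p) * c"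
      using lookup_mult_top[of p "lead_exp p" t w] by (simp add: keys_le_lead_exp keys_t) (simp add: t_def)
    then have same: "Poly_Mapping.lookup y (lead_exp y) = Poly_Mapping.lookup (p * t) (lead_exp y)"
      using lookup n w(1) unfolding c_def by (simp add: add.commute)
    \<comment> \<open>Subtracting \<open>p * t\<close> from \<open>y\<close> and
      \<open>q * t\<close> from \<open>z\<close> preserves the relation, so the induction applies to
      the smaller leading exponent.\<close>
    have eq: "q * (y - p * t) = p * (z - q * t)"
      using less.prems(3) by (simp add: algebra_simps)
    have "\<exists>v\<in>?C. y - p * t = p * v"
    proof (cases "y - p * t = 0")
      case True
      then show ?thesis
        using zero by (intro bexI[of _ 0]) auto
    next
      case False
      show ?thesis
        by (rule less.hyps[OF lead_exp_cancel[OF lead_pt same False] y' z' eq])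
    qed
    then obtain v where "v \<in> ?C" "y - p * t = p * v"
      by blast
    then have "v + t \<in> ?C" "y = p * (v + t)"
      using t(3) keys_subset_plus[of v "monoid_span A" t] by (auto simp: algebra_simps)
    then show ?thesis
      by blast
  qed
qed

text \<open>Since \<open>x \<noteq> 0\<close>, distinct powers of the monomial have distinct
  exponents and no terms cancel.\<close>

lemma polynomial_in_monomial:
  fixes k :: "nat \<Rightarrow> 'k::field" and x :: "nat \<times> nat"
  assumes "x \<noteq> 0" "n < N" "k n \<noteq> 0"
  defines "h \<equiv> \<Sum>j<N. Poly_Mapping.single x 1 ^ j * Poly_Mapping.single 0 (k j)"
  shows "h \<noteq> 0" "Poly_Mapping.keys h \<subseteq> range (\<lambda>n. (n * fst x, n * snd x))"
proof -
  have pow: "Poly_Mapping.single x (1::'k) ^ j = Poly_Mapping.single (j * fst x, j * snd x) 1" for j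
    by (induction j) (simp_all add: mult_single zero_prod_def[symmetric] plus_prod_def)
  have h: "h = (\<Sum>j<N. Poly_Mapping.single (j * fst x, j * snd x) (k j))"
    unfolding h_def pow by (simp add: mult_single)
  have inj: "(j * fst x, j * snd x) = (n * fst x, n * snd x) \<longleftrightarrow> j = n" for j
    using assms(1) by (auto simp: prod_eq_iff)
  have "Poly_Mapping.lookup h (n * fst x, n * snd x) = (\<Sum>j<N. if j = n then k j else 0)"
    unfolding h lookup_sum lookup_single when_def inj ..
  also have "\<dots> = k n"
    using assms(2) by simp
  finally show "h \<noteq> 0"
    using assms(3) by auto
  show "Poly_Mapping.keys h \<subseteq> range (\<lambda>n. (n * fst x, n * snd x))"
  proof
    fix v assume "v \<in> Poly_Mapping.keys h"
    then obtain j where "v \<in> Poly_Mapping.keys (Poly_Mapping.single (j * fst x, j * snd x) (k j))"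
      unfolding h using Poly_Mapping.keys_sum by (metis (no_types, lifting) UN_iff subsetD)
    then show "v \<in> range (\<lambda>n. (n * fst x, n * snd x))"
      by (auto split: if_splits)
  qed
qed

lemma cohen_macaulay_of_descending:
  fixes A :: "(nat \<times> nat) set"
  assumes "finite A" "0 < d" "(d, 0) \<in> monoid_span A" "(0, d) \<in> monoid_span A"
    and descend: "\<And>x. x + (d, 0) \<in> monoid_span A \<Longrightarrow> x + (0, d) \<in> monoid_span A \<Longrightarrow> x \<in> monoid_span A"
  shows "cohen_macaulay (semigroup_ring (monoid_span A) :: (nat \<times> nat \<Rightarrow>\<^sub>0 'k::field) ring)"
    (is "cohen_macaulay ?R")
proof -
  interpret R: domain ?R
    by (rule domain_semigroup_ring)
  have noeth: "noetherian_ring ?R"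
    by (rule noetherian_semigroup_ring[OF assms(1)])
  have "cohen_macaulay_local (localization_at ?R M)" if "maximalideal M ?R" for M
  proof -
    have M: "primeideal M ?R"
      by (rule R.maximalideal_prime[OF that])
    interpret M: primeideal M ?R by fact
    define U where "U = carrier ?R - M"
    interpret L: mult_set ?R U
      unfolding U_def by (rule mult_set_compl_primeideal[OF M])
    have MU: "M \<inter> U = {}"
      unfolding U_def by blast
    have zero: "\<zero>\<^bsub>?R\<^esub> \<notin> U"
      unfolding U_def using additive_subgroup.zero_closed[OF ideal.axioms(1)[OF M.is_ideal]] by blast
    have E: "primeideal (L.extension M) (localization ?R U)"
      by (rule L.primeideal_extension[OF M MU])
    interpret E: primeideal "L.extension M" "localization ?R U" by fact
    have ext: "L.frac f \<one>\<^bsub>?R\<^esub> \<in> L.extension M" if "f \<in> M" for f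
      by (rule L.extensionI[OF that L.U_one])
    \<comment> \<open>The opposite inequality holds in general. It remains to find, for each chain
      in the localization, a regular sequence at least as long; the chain is pulled back to primes
      of the semigroup ring inside \<open>M\<close>.\<close>
    have "krull_dim (localization ?R U) \<le> depth (localization ?R U) (L.extension M)"
      unfolding krull_dim_def
    proof (rule Sup_least)
      fix e assume "e \<in> {enat n |n. \<exists>P. (\<forall>i\<le>n. primeideal (P i) (localization ?R U)) \<and> (\<forall>i<n. P i \<subset> P (Suc i))}"
      then obtain n where e: "e = enat n" and
        "\<exists>P. (\<forall>i\<le>n. primeideal (P i) (localization ?R U)) \<and> (\<forall>i<n. P i \<subset> P (Suc i))"
        by blast
      then obtain P where P: "\<forall>i\<le>n. primeideal (P i) (localization ?R U)" "\<forall>i<n. P i \<subset> P (Suc i)"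
        by (elim exE conjE)
      define Q where "Q i = L.contraction (P i)" for i
      have Q: "primeideal (Q i) ?R" "Q i \<subseteq> M" if "i \<le> n" for i
      proof -
        have Pi: "primeideal (P i) (localization ?R U)"
          using P(1) that by blast
        show "primeideal (Q i) ?R"
          unfolding Q_def by (rule L.primeideal_contraction(1)[OF Pi])
        show "Q i \<subseteq> M"
          unfolding Q_def by (rule L.contraction_subset[OF Pi U_def])
      qed
      have Q_mono: "Q i \<subset> Q (Suc i)" if "i < n" for i
        unfolding Q_def
      proof (rule L.contraction_strict_mono)
        show "ideal (P i) (localization ?R U)" "ideal (P (Suc i)) (localization ?R U)" "P i \<subset> P (Suc i)"
          using P that by (simp_all add: primeideal.axioms(1))
      qed
      consider "n = 0" | "n = 1" | "n = 2" | "3 \<le> n"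
        by linarith
      then show "e \<le> depth (localization ?R U) (L.extension M)"
      proof cases
        case 1
        then show ?thesis
          by (simp add: e zero_enat_def[symmetric])
      next
        case 2
        then obtain f where f: "f \<in> Q 1" "f \<notin> Q 0"
          using Q_mono[of 0] by auto
        then have fM: "f \<in> M" "f \<in> carrier ?R"
          using Q(2)[of 1] 2 M.Icarr by auto
        have "\<zero>\<^bsub>?R\<^esub> \<in> Q 0"
          using additive_subgroup.zero_closed[OF ideal.axioms(1)[OF primeideal.axioms(1)[OF Q(1)[of 0]]]] by simp
        then have "f \<noteq> \<zero>\<^bsub>?R\<^esub>"
          using f(2) by blast
        then have "regular_sequence (localization ?R U) [L.frac f \<one>\<^bsub>?R\<^esub>]"
          using L.regular_sequence_single[OF R.domain_axioms zero fM(2) _ E.is_ideal _ ext[OF fM(1)]]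
            E.I_notcarr by blast
        from le_depthI[OF this] show ?thesis
          using ext[OF fM(1)] 2 by (simp add: e)
      next
        case 3
        have chain: "Q 0 \<subset> Q 1" "Q 1 \<subset> Q 2"
          using Q_mono[of 0] Q_mono[of 1] 3 by (simp_all add: numeral_2_eq_2)
        have prime: "primeideal (Q 0) ?R" "primeideal (Q 1) ?R" "primeideal (Q 2) ?R"
          using Q(1) 3 by auto
        \<comment> \<open>A monomial is algebraic modulo \<open>Q 2\<close>; the relation is itself
          a nonzero polynomial in that monomial and lies in \<open>Q 2\<close>, hence in
          \<open>M\<close>.\<close>
        have poly: "\<exists>h\<in>M. h \<noteq> 0 \<and> Poly_Mapping.keys h \<subseteq> range (\<lambda>n. (n * fst x, n * snd x))"
          if x: "x \<in> monoid_span A" "x \<noteq> 0" for x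
        proof -
          obtain N n and k :: "nat \<Rightarrow> 'k" where k: "n < N" "k n \<noteq> 0"
            "(\<Sum>j<N. Poly_Mapping.single x 1 ^ j * Poly_Mapping.single 0 (k j)) \<in> Q 2"
            by (rule algebraic_modulo_chain[OF prime chain single_in_semigroup_ring[OF x(1), of 1]])
          then show ?thesis
            using polynomial_in_monomial[of x n N k] x(2) Q(2)[of 2] 3 by blast
        qed
        obtain p where p: "p \<in> M" "p \<noteq> 0" "Poly_Mapping.keys p \<subseteq> range (\<lambda>n. (n * d, 0))"
          using poly[OF assms(3)] assms(2) by (auto simp: zero_prod_def)
        obtain q where q: "q \<in> M" "q \<noteq> 0" "Poly_Mapping.keys q \<subseteq> range (\<lambda>n. (0, n * d))"
          using poly[OF assms(4)] assms(2) by (auto simp: zero_prod_def)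
        have pq: "p \<in> carrier ?R" "q \<in> carrier ?R"
          using p(1) q(1) M.Icarr by blast+
        have "regular_sequence (localization ?R U) [L.frac p \<one>\<^bsub>?R\<^esub>, L.frac q \<one>\<^bsub>?R\<^esub>]"
        proof (rule L.regular_sequence_pair[OF R.domain_axioms zero pq(1) _ pq(2) _ E.is_ideal _ ext[OF p(1)] ext[OF q(1)]])
          show "p \<noteq> \<zero>\<^bsub>?R\<^esub>" "L.extension M \<noteq> carrier (localization ?R U)"
            using p(2) E.I_notcarr by auto
          show "\<exists>w\<in>carrier ?R. y = p \<otimes>\<^bsub>?R\<^esub> w"
            if "y \<in> carrier ?R" "z \<in> carrier ?R" "q \<otimes>\<^bsub>?R\<^esub> y = p \<otimes>\<^bsub>?R\<^esub> z" for y z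
            using regular_pair_semigroup_ring[OF assms(3,4) descend p(2,3) pq(1) q(2,3) pq(2) that(1,2)] that(3)
            by (simp only: semigroup_ring_simps)
        qed
        from le_depthI[OF this] show ?thesis
          using ext[OF p(1)] ext[OF q(1)] 3 by (simp add: e numeral_2_eq_2)
      next
        case 4
        have "Q 0 \<subset> Q 1" "Q 1 \<subset> Q 2" "Q 2 \<subset> Q 3"
          using Q_mono[of 0] Q_mono[of 1] Q_mono[of 2] 4 by (simp_all add: numeral_2_eq_2 numeral_3_eq_3)
        then have False
          using no_prime_chain_of_length_three[OF Q(1) Q(1) Q(1) Q(1), of 0 1 2 3] 4 by simp
        then show ?thesis ..
      qed
    qed
    then have "depth (localization ?R U) (L.extension M) = krull_dim (localization ?R U)"
      using L.loc.depth_le_krull_dim[OF E] by simp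
    then show ?thesis
      unfolding localization_at_def cohen_macaulay_local_def U_def[symmetric]
      using L.cring_localization L.noetherian_ring_localization[OF noeth]
        L.maximalideal_localization_iff[OF M U_def] by blast
  qed
  then show ?thesis
    unfolding cohen_macaulay_def using noeth R.is_cring by blast
qed


section \<open>Socle exponents and the failure of depth two\<close>

lemma sum_const_lessThan_prod: "(\<Sum>i<(n::nat). g) = (n * fst g, n * snd g)"
  for g :: "nat \<times> nat"
  by (induction n) (simp_all add: prod_eq_iff)

text \<open>A pigeonhole bound: if the new generator \<open>g\<close> occurs fewer than
  \<open>d\<close> times, removing it lowers the degree by at most
  \<open>d * (fst g + snd g)\<close>, and the bound for the other generators applies.\<close>

lemma monoid_span_large_multiple:
  fixes A :: "(nat \<times> nat) set" and d :: nat
  assumes "finite A"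
  shows "\<exists>B. \<forall>s\<in>monoid_span A. B < fst s + snd s \<longrightarrow>
    (\<exists>g\<in>A. \<exists>t\<in>monoid_span A. s = (\<Sum>i<d. g) + t)"
  using assms
proof (induction A rule: finite_induct)
  case empty
  have "s = 0" if "s \<in> monoid_span {}" for s :: "nat \<times> nat"
    using that by induction auto
  then show ?case
    by fastforce
next
  case (insert g A)
  then obtain B where B: "\<forall>s\<in>monoid_span A. B < fst s + snd s \<longrightarrow>
      (\<exists>g\<in>A. \<exists>t\<in>monoid_span A. s = (\<Sum>i<d. g) + t)"
    by (elim exE)
  have sub: "t \<in> monoid_span (insert g A)" if "t \<in> monoid_span A" for t
    using that monoid_span_mono[of A "insert g A"] by auto
  have mult: "(\<Sum>i<n. g) \<in> monoid_span (insert g A)" for n :: nat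
    by (intro monoid_span_multiple monoid_span.gen) simp
  have "\<exists>g'\<in>insert g A. \<exists>t\<in>monoid_span (insert g A). s = (\<Sum>i<d. g') + t"
    if s: "s \<in> monoid_span (insert g A)" "B + d * (fst g + snd g) < fst s + snd s" for s
  proof -
    obtain n m where m: "m \<in> monoid_span A" "s = (\<Sum>i<(n::nat). g) + m"
      using monoid_span_insert_cases[OF s(1)] by blast
    show ?thesis
    proof (cases "d \<le> n")
      case True
      then have "s = (\<Sum>i<d. g) + ((\<Sum>i<n - d. g) + m)"
        using m(2) sum_const_lessThan_add[of g d "n - d"] by (simp add: add.assoc)
      moreover have "(\<Sum>i<n - d. g) + m \<in> monoid_span (insert g A)"
        by (rule monoid_span.add[OF mult sub[OF m(1)]])
      ultimately show ?thesis
        by blast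
    next
      case False
      then have "n * (fst g + snd g) \<le> d * (fst g + snd g)"
        by simp
      then have "B < fst m + snd m"
        using s(2) unfolding m(2) sum_const_lessThan_prod by (simp add: algebra_simps)
      with B m(1) obtain g' t where t: "g' \<in> A" "t \<in> monoid_span A" "m = (\<Sum>i<d. g') + t"
        by blast
      then have "s = (\<Sum>i<d. g') + ((\<Sum>i<n. g) + t)"
        using m(2) by (simp add: add.left_commute)
      moreover have "(\<Sum>i<n. g) + t \<in> monoid_span (insert g A)"
        by (rule monoid_span.add[OF mult sub[OF t(2)]])
      ultimately show ?thesis
        using t(1) by blast
    qed
  qed
  then show ?case
    by blast
qed

text \<open>Among the \<open>s \<in> monoid_span A\<close> with \<open>x + s\<close> still outside
  the monoid, one of maximal degree gives \<open>y = x + s\<close>. The degree is bounded because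
  \<open>d\<close> copies of a generator split into copies of \<open>(d, 0)\<close> and
  \<open>(0, d)\<close>.\<close>

lemma socle_exponent:
  fixes A :: "(nat \<times> nat) set"
  assumes "finite A" "0 \<notin> A" "(d, 0) \<in> monoid_span A" "(0, d) \<in> monoid_span A"
    and x: "x \<notin> monoid_span A" "x + (d, 0) \<in> monoid_span A" "x + (0, d) \<in> monoid_span A"
  obtains y where "y \<notin> monoid_span A" "\<And>t. t \<in> monoid_span A \<Longrightarrow> t \<noteq> 0 \<Longrightarrow> y + t \<in> monoid_span A"
proof -
  obtain B where B: "\<forall>s\<in>monoid_span A. B < fst s + snd s \<longrightarrow>
      (\<exists>g\<in>A. \<exists>t\<in>monoid_span A. s = (\<Sum>i<d. g) + t)"
    using monoid_span_large_multiple[OF assms(1), of d] by (elim exE)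
  let ?X = "\<lambda>s. s \<in> monoid_span A \<and> x + s \<notin> monoid_span A"
  have bound: "fst s + snd s \<le> B" if s: "?X s" for s
  proof (rule ccontr)
    assume "\<not> ?thesis"
    then obtain g t where gt: "g \<in> A" "t \<in> monoid_span A" "s = (\<Sum>i<d. g) + t"
      using B s by (meson not_le)
    have e1: "(\<Sum>i<n. (d, 0)) \<in> monoid_span A" and e2: "(\<Sum>i<n. (0, d)) \<in> monoid_span A" for n :: nat
      using assms(3,4) by (simp_all add: monoid_span_multiple)
    have "fst g \<noteq> 0 \<or> snd g \<noteq> 0"
      using gt(1) assms(2) by (metis prod_eq_iff fst_zero snd_zero)
    then show False
    proof
      assume "fst g \<noteq> 0"
      \<comment> \<open>The multiple \<open>d * g\<close> equals \<open>fst g\<close> copies of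
        \<open>(d, 0)\<close> plus \<open>snd g\<close> copies of \<open>(0, d)\<close>; one copy is
        spent on bringing \<open>x\<close> into the monoid.\<close>
      then have "x + s = x + (d, 0) + ((\<Sum>i<fst g - 1. (d, 0)) + (\<Sum>i<snd g. (0, d)) + t)"
        unfolding gt(3) sum_const_lessThan_prod by (cases "fst g") (auto simp: prod_eq_iff algebra_simps)
      then show False
        using s x(2) e1 e2 gt(2) by (metis monoid_span.add)
    next
      assume "snd g \<noteq> 0"
      then have "x + s = x + (0, d) + ((\<Sum>i<fst g. (d, 0)) + (\<Sum>i<snd g - 1. (0, d)) + t)"
        unfolding gt(3) sum_const_lessThan_prod by (cases "snd g") (auto simp: prod_eq_iff algebra_simps)
      then show False
        using s x(3) e1 e2 gt(2) by (metis monoid_span.add)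
    qed
  qed
  have "?X 0"
    using x(1) by (simp add: monoid_span.zero)
  moreover have "\<forall>s. ?X s \<longrightarrow> fst s + snd s < Suc B"
    using bound by (simp add: less_Suc_eq_le)
  ultimately have "\<exists>s. ?X s \<and> (\<forall>t. ?X t \<longrightarrow> fst t + snd t \<le> fst s + snd s)"
    by (rule ex_has_greatest_nat)
  then obtain s where s: "?X s" "\<forall>t. ?X t \<longrightarrow> fst t + snd t \<le> fst s + snd s"
    by (elim exE conjE) blast
  have "x + s + t \<in> monoid_span A" if t: "t \<in> monoid_span A" "t \<noteq> 0" for t
  proof (rule ccontr)
    assume "x + s + t \<notin> monoid_span A"
    then have "?X (s + t)"
      using s(1) t(1) by (simp add: monoid_span.add add.assoc)
    then have "fst (s + t) + snd (s + t) \<le> fst s + snd s"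
      by (rule s(2)[rule_format])
    then show False
      using t(2) by (auto simp: prod_eq_iff)
  qed
  then show ?thesis
    using that[of "x + s"] s(1) by blast
qed

text \<open>An element outside the ideal has nonzero constant term; modulo the ideal it equals that
  constant, which is a unit.\<close>

lemma maximalideal_irrelevant:
  fixes A :: "(nat \<times> nat) set"
  shows "maximalideal {f. Poly_Mapping.keys f \<subseteq> monoid_span A - {0}}
    (semigroup_ring (monoid_span A) :: (nat \<times> nat \<Rightarrow>\<^sub>0 'k::field) ring)" (is "maximalideal ?M ?R")
proof (rule maximalidealI)
  have prime: "primeideal ?M ?R"
    by (rule primeideal_face) (auto simp: prod_eq_iff)
  then show "ideal ?M ?R"
    by (rule primeideal.axioms(1))
  show "carrier ?R \<noteq> ?M"
    by (rule primeideal.I_notcarr[OF prime])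
  fix J assume J: "ideal J ?R" "?M \<subseteq> J" "J \<subseteq> carrier ?R"
  have "J = carrier ?R" if f: "f \<in> J" "f \<notin> ?M" for f
  proof -
    let ?c = "Poly_Mapping.lookup f 0"
    have keys: "Poly_Mapping.keys f \<subseteq> monoid_span A"
      using f(1) J(3) by auto
    then have c: "?c \<noteq> 0"
      using f(2) by (auto simp: in_keys_iff)
    have "f - Poly_Mapping.single 0 ?c \<in> ?M"
      using keys by (auto simp: in_keys_iff lookup_minus lookup_single when_def split: if_splits)
    then have "f - (f - Poly_Mapping.single 0 ?c) \<in> J"
      using J(2) f(1) semigroup_ring_ideal_closed(5)[OF J(1)] by blast
    then have "Poly_Mapping.single 0 (inverse ?c) * Poly_Mapping.single 0 ?c \<in> J"
      by (intro semigroup_ring_ideal_closed(3)[OF J(1)]) (auto simp: monoid_span.zero)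
    then have "\<one>\<^bsub>?R\<^esub> \<in> J"
      using c by (simp add: mult_single)
    then show ?thesis
      using ideal.one_imp_carrier[OF J(1)] by blast
  qed
  then show "J = ?M \<or> J = carrier ?R"
    using J(2) by blast
qed

text \<open>By cancellation only the constant term of \<open>f\<close> reaches the exponent
  \<open>y\<close>. This detects \<open>y\<close> in the product of a denominator with the monomial
  at \<open>y\<close>.\<close>

lemma lookup_mult_single_self:
  fixes f :: "'a::cancel_comm_monoid_add \<Rightarrow>\<^sub>0 'k::comm_ring_1"
  shows "Poly_Mapping.lookup (f * Poly_Mapping.single y 1) y = Poly_Mapping.lookup f 0"
proof -
  let ?s = "Poly_Mapping.single 0 (Poly_Mapping.lookup f 0)"
  have "y \<notin> Poly_Mapping.keys ((f - ?s) * Poly_Mapping.single y 1)"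
  proof
    assume "y \<in> Poly_Mapping.keys ((f - ?s) * Poly_Mapping.single y 1)"
    then obtain a b where "y = a + b" "a \<in> Poly_Mapping.keys (f - ?s)"
      "b \<in> Poly_Mapping.keys (Poly_Mapping.single y (1::'k))"
      using keys_mult by blast
    then have "0 \<in> Poly_Mapping.keys (f - ?s)"
      by (auto split: if_splits)
    then show False
      by (simp add: in_keys_iff lookup_minus)
  qed
  moreover have "f * Poly_Mapping.single y 1 = ?s * Poly_Mapping.single y 1 + (f - ?s) * Poly_Mapping.single y 1"
    by (simp add: algebra_simps)
  ultimately show ?thesis
    by (simp add: lookup_add mult_single in_keys_iff)
qed

text \<open>If \<open>S\<close> is not closed under descent, it has a socle exponent \<open>y \<notin> S\<close> with \<open>y + s \<in> S\<close> for
  all \<open>s \<noteq> 0\<close>. For \<open>z = t\<^sup>y\<close> and a regular sequence \<open>f, g\<close> at the irrelevant maximal ideal,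
  \<open>g (z f) = f (z g)\<close> then forces \<open>z f\<close> to be a multiple of \<open>f\<close>, that is, \<open>z\<close> to lie
  in the local ring.\<close>
lemma descending_of_cohen_macaulay:
  fixes A :: "(nat \<times> nat) set"
  assumes "finite A" "0 \<notin> A" "0 < d" "(d, 0) \<in> monoid_span A" "(0, d) \<in> monoid_span A"
    and CM: "cohen_macaulay (semigroup_ring (monoid_span A) :: (nat \<times> nat \<Rightarrow>\<^sub>0 'k::field) ring)"
    and x: "x + (d, 0) \<in> monoid_span A" "x + (0, d) \<in> monoid_span A"
  shows "x \<in> monoid_span A"
proof (rule ccontr)
  assume "x \<notin> monoid_span A"
  then obtain y where y: "y \<notin> monoid_span A" "\<And>t. t \<in> monoid_span A \<Longrightarrow> t \<noteq> 0 \<Longrightarrow> y + t \<in> monoid_span A"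
    using socle_exponent[OF assms(1,2,4,5) _ x] by metis
  let ?R = "semigroup_ring (monoid_span A) :: (nat \<times> nat \<Rightarrow>\<^sub>0 'k) ring"
  interpret R: domain ?R
    by (rule domain_semigroup_ring)
  define I :: "(nat \<times> nat) set \<Rightarrow> (nat \<times> nat \<Rightarrow>\<^sub>0 'k) set"
    where "I F = {f. Poly_Mapping.keys f \<subseteq> monoid_span A - F}" for F
  define M where "M = I {0}"
  have max: "maximalideal M ?R"
    unfolding M_def I_def by (rule maximalideal_irrelevant)
  have M: "primeideal M ?R"
    by (rule R.maximalideal_prime[OF max])
  interpret M: primeideal M ?R by fact
  define U where "U = carrier ?R - M"
  interpret L: mult_set ?R U
    unfolding U_def by (rule mult_set_compl_primeideal[OF M])
  let ?L = "localization ?R U"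
  have zero: "\<zero>\<^bsub>?R\<^esub> \<notin> U"
    unfolding U_def using additive_subgroup.zero_closed[OF ideal.axioms(1)[OF M.is_ideal]] by blast
  have "cohen_macaulay_local ?L"
    using CM max unfolding cohen_macaulay_def localization_at_def U_def by blast
  then obtain N where "\<forall>N'. maximalideal N' ?L \<longleftrightarrow> N' = N" "depth ?L N = krull_dim ?L"
    unfolding cohen_macaulay_local_def by blast
  then have depth: "depth ?L (L.extension M) = krull_dim ?L"
    using L.maximalideal_localization_iff[OF M U_def] by metis
  \<comment> \<open>Faces shrinking from the whole plane through the first axis to the origin; their
    primes ascend from the zero ideal to \<open>M\<close> and show that the local dimension is at
    least two.\<close>
  define F where "F i = (if i = 0 then UNIV else if i = 1 then {x. snd x = 0} else {0 :: nat \<times> nat})" for i :: nat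
  have prime: "primeideal (I (F i)) ?R" for i
    unfolding I_def by (rule primeideal_face) (auto simp: F_def prod_eq_iff)
  have "0 \<in> F i" for i
    unfolding F_def by (auto simp: prod_eq_iff)
  then have disj: "I (F i) \<inter> U = {}" for i
    unfolding U_def M_def I_def by auto
  have strict: "I (F i) \<subset> I (F (Suc i))" if "i < 2" for i
  proof (rule psubsetI)
    show "I (F i) \<subseteq> I (F (Suc i))"
      unfolding I_def F_def by auto
    have "Poly_Mapping.single (if i = 0 then (0, d) else (d, 0)) 1 \<in> I (F (Suc i)) - I (F i)"
      using that assms(3-5) unfolding I_def F_def by (auto simp: prod_eq_iff)
    then show "I (F i) \<noteq> I (F (Suc i))"
      by blast
  qed
  have "enat (Suc 1) \<le> krull_dim ?L"
    unfolding krull_dim_def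
  proof (intro Sup_upper CollectI exI conjI)
    show "enat (Suc 1) = enat 2"
      by simp
    show "\<forall>i\<le>2. primeideal (L.extension (I (F i))) ?L"
      using L.primeideal_extension[OF prime disj] by blast
    show "\<forall>i<2. L.extension (I (F i)) \<subset> L.extension (I (F (Suc i)))"
      using L.extension_strict_mono[OF prime disj prime disj strict] by blast
  qed
  then obtain xs where xs: "regular_sequence ?L xs" "set xs \<subseteq> L.extension M" "Suc 1 \<le> length xs"
    unfolding depth[symmetric] by (rule le_depthE)
  have len: "0 < length xs" "1 < length xs"
    using xs(3) by linarith+
  have "xs ! 0 \<in> L.extension M" "xs ! 1 \<in> L.extension M"
    using xs(2) nth_mem[OF len(1)] nth_mem[OF len(2)] by blast+
  then obtain f s g s' where f: "xs ! 0 = L.frac f s" "f \<in> M" "s \<in> U"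
    and g: "xs ! 1 = L.frac g s'" "g \<in> M" "s' \<in> U"
    unfolding L.extension_def by blast
  have carr: "f \<in> carrier ?R" "g \<in> carrier ?R" "s \<in> carrier ?R" "s' \<in> carrier ?R"
    using f g M.Icarr L.U_carrier by blast+
  \<comment> \<open>A zero first element would annihilate \<open>\<one>\<close>, and regularity
    would put \<open>\<one>\<close> into the zero ideal.\<close>
  have f0: "f \<noteq> 0"
  proof
    assume "f = 0"
    then have "xs ! 0 = \<zero>\<^bsub>?L\<^esub>"
      unfolding f(1) L.localization_zero using carr f(3) L.U_one
      by (subst L.fraction_eq_iff_domain[OF R.domain_axioms zero]) auto
    then have "xs ! 0 \<otimes>\<^bsub>?L\<^esub> \<one>\<^bsub>?L\<^esub> \<in> genideal ?L (set (take 0 xs))"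
      by (simp add: L.genideal_empty)
    then have "\<one>\<^bsub>?L\<^esub> \<in> genideal ?L {}"
      using xs(1) len(1) unfolding regular_sequence_def by fastforce
    then have "L.frac \<one>\<^bsub>?R\<^esub> \<one>\<^bsub>?R\<^esub> = L.frac \<zero>\<^bsub>?R\<^esub> \<one>\<^bsub>?R\<^esub>"
      by (simp add: L.genideal_empty L.localization_one L.localization_zero)
    then show False
      using L.U_one by (subst (asm) L.fraction_eq_iff_domain[OF R.domain_axioms zero]) (auto simp: monoid_span.zero)
  qed
  \<comment> \<open>The monomial at the socle exponent: outside the ring, yet it multiplies
    \<open>M\<close> into the ring.\<close>
  define z where "z = Poly_Mapping.single y (1::'k)"
  have z_mult: "z * h \<in> carrier ?R" if "h \<in> M" for h
  proof -
    have "k \<in> monoid_span A" if k: "k \<in> Poly_Mapping.keys (z * h)" for k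
    proof -
      obtain t where "k = y + t" "t \<in> Poly_Mapping.keys h"
        using k keys_mult[of z h] by (auto simp: z_def split: if_splits)
      moreover have "Poly_Mapping.keys h \<subseteq> monoid_span A - {0}"
        using \<open>h \<in> M\<close> unfolding M_def I_def by simp
      ultimately show ?thesis
        using y(2) by blast
    qed
    then show ?thesis
      by auto
  qed
  define Y where "Y = L.frac (z * f) s"
  have Y: "Y \<in> carrier ?L"
    unfolding Y_def using z_mult[OF f(2)] f(3) by (rule L.frac_closed)
  have F: "L.frac f s \<in> carrier ?L"
    using carr(1) f(3) by (rule L.frac_closed)
  have W: "L.frac (z * g) s' \<in> carrier ?L"
    using z_mult[OF g(2)] g(3) by (rule L.frac_closed)
  have "L.frac g s' \<otimes>\<^bsub>?L\<^esub> Y = L.frac (g \<otimes>\<^bsub>?R\<^esub> (z * f)) (s' \<otimes>\<^bsub>?R\<^esub> s)"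
    unfolding Y_def by (rule L.localization_mult[OF carr(2) g(3) z_mult[OF f(2)] f(3)])
  also have "\<dots> = L.frac ((z * g) \<otimes>\<^bsub>?R\<^esub> f) (s' \<otimes>\<^bsub>?R\<^esub> s)"
    by (simp add: ac_simps)
  also have "\<dots> = L.frac (z * g) s' \<otimes>\<^bsub>?L\<^esub> L.frac f s"
    by (rule L.localization_mult[OF z_mult[OF g(2)] g(3) carr(1) f(3), symmetric])
  also have "\<dots> \<in> genideal ?L {L.frac f s}"
    unfolding L.loc.cgenideal_eq_genideal[OF F, symmetric] cgenideal_def using W by blast
  also have "{L.frac f s} = set (take 1 xs)"
    using len f(1) by (cases xs) auto
  finally have "xs ! 1 \<otimes>\<^bsub>?L\<^esub> Y \<in> genideal ?L (set (take 1 xs))"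
    unfolding g(1) .
  then have "Y \<in> genideal ?L (set (take 1 xs))"
    using xs(1) len(2) Y unfolding regular_sequence_def by blast
  also have "set (take 1 xs) = {L.frac f s}"
    using len f(1) by (cases xs) auto
  finally obtain W where "W \<in> carrier ?L" "Y = W \<otimes>\<^bsub>?L\<^esub> L.frac f s"
    unfolding L.loc.cgenideal_eq_genideal[OF F, symmetric] cgenideal_def by blast
  then obtain r t where rt: "r \<in> carrier ?R" "t \<in> U" "Y = L.frac r t \<otimes>\<^bsub>?L\<^esub> L.frac f s"
    unfolding L.carrier_localization by blast
  have tR: "t \<in> carrier ?R"
    using rt(2) by (rule L.U_carrier)
  have "L.frac (z * f) s = L.frac (r \<otimes>\<^bsub>?R\<^esub> f) (t \<otimes>\<^bsub>?R\<^esub> s)"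
    using rt(3) L.localization_mult[OF rt(1,2) carr(1) f(3)] unfolding Y_def by simp
  then have "(t \<otimes>\<^bsub>?R\<^esub> s) \<otimes>\<^bsub>?R\<^esub> (z * f) = s \<otimes>\<^bsub>?R\<^esub> (r \<otimes>\<^bsub>?R\<^esub> f)"
    using L.fraction_eq_iff_domain[OF R.domain_axioms zero z_mult[OF f(2)] f(3)
        R.m_closed[OF rt(1) carr(1)] L.U_mult[OF rt(2) f(3)]] by simp
  \<comment> \<open>After cancellation, \<open>t * z = r\<close> lies in the ring. Since
    \<open>t \<notin> M\<close> has a nonzero constant term, \<open>y\<close> occurs in
    \<open>r\<close>, which contradicts \<open>y \<notin> monoid_span A\<close>.\<close>
  then have "(s * f) * (t * z) = (s * f) * r"
    by (simp add: ac_simps)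
  moreover have "s \<noteq> 0"
    using f(3) zero by auto
  ultimately have "t * z = r"
    using f0 by simp
  moreover have "Poly_Mapping.lookup t 0 \<noteq> 0"
    using rt(2) tR unfolding U_def M_def I_def by (auto simp: in_keys_iff)
  ultimately have "y \<in> Poly_Mapping.keys r"
    using lookup_mult_single_self[of t y] unfolding z_def by (auto simp: in_keys_iff)
  then show False
    using rt(1) y(1) by auto
qed

section \<open>Sumsets\<close>

fun sumset :: "nat set \<Rightarrow> nat \<Rightarrow> nat set" where
  "sumset A 0 = {0}"
| "sumset A (Suc n) = {x + y | x y. x \<in> A \<and> y \<in> sumset A n}"

lemma sumset_Suc_I: "x \<in> A \<Longrightarrow> y \<in> sumset A n \<Longrightarrow> x + y \<in> sumset A (Suc n)"
  by auto

lemma sumset_Suc_E: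
  assumes "x \<in> sumset A (Suc n)"
  obtains u v where "x = u + v" "u \<in> A" "v \<in> sumset A n"
  using assms by auto

lemma sumset_1 [simp]: "sumset A (Suc 0) = A"
  by simp

lemma sumset_2: "sumset A 2 = {x + y | x y. x \<in> A \<and> y \<in> A}"
  by (simp add: numeral_2_eq_2)

declare sumset.simps(2) [simp del]

lemma sumset_add:
  assumes "x \<in> sumset A m" "y \<in> sumset A n"
  shows "x + y \<in> sumset A (m + n)"
  using assms
proof (induction m arbitrary: x)
  case (Suc m)
  then obtain u v where "x = u + v" "u \<in> A" "v \<in> sumset A m"
    using sumset_Suc_E by blast
  with Suc show ?case
    using sumset_Suc_I[of u A "v + y"] by (simp add: add.assoc)
qed simp

lemma sumset_mono:
  assumes "0 \<in> A" "m \<le> n" "x \<in> sumset A m"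
  shows "x \<in> sumset A n"
  using assms(2,3)
proof (induction n rule: dec_induct)
  case (step n)
  then show ?case
    using sumset_Suc_I[OF assms(1), of x n] by simp
qed

lemma monoid_span_eq_sumset: "x \<in> monoid_span A \<longleftrightarrow> (\<exists>n. x \<in> sumset A n)"
proof
  assume "x \<in> monoid_span A"
  then show "\<exists>n. x \<in> sumset A n"
  proof induction
    case zero
    show ?case
      by (rule exI[of _ 0]) simp
  next
    case (gen x)
    then show ?case
      by (intro exI[of _ "Suc 0"]) simp
  next
    case (add x y)
    then show ?case
      using sumset_add by blast
  qed
next
  assume "\<exists>n. x \<in> sumset A n"
  then obtain n where "x \<in> sumset A n"
    by blast
  then show "x \<in> monoid_span A"
  proof (induction n arbitrary: x)
    case (Suc n)
    then obtain u v where "x = u + v" "u \<in> A" "v \<in> sumset A n"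
      using sumset_Suc_E by blast
    with Suc.IH show ?case
      by (auto intro: monoid_span.add monoid_span.gen)
  qed (simp add: monoid_span.zero)
qed

text \<open>Each summand is replaced by its complement in \<open>d\<close>. Bound and membership
  share one induction because the truncated differences need the bound.\<close>

lemma sumset_reflect:
  assumes "A \<subseteq> {..d}" "x \<in> sumset A n"
  shows "x \<le> n * d" "n * d - x \<in> sumset ((\<lambda>a. d - a) ` A) n"
proof -
  have "x \<le> n * d \<and> n * d - x \<in> sumset ((\<lambda>a. d - a) ` A) n"
    using assms(2)
  proof (induction n arbitrary: x)
    case (Suc n)
    then obtain u v where uv: "x = u + v" "u \<in> A" "v \<in> sumset A n"
      using sumset_Suc_E by blast
    then have v: "v \<le> n * d" "n * d - v \<in> sumset ((\<lambda>a. d - a) ` A) n" and u: "u \<le> d"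
      using Suc.IH assms(1) by auto
    have "Suc n * d - x = (d - u) + (n * d - v)"
      using u v(1) uv(1) by simp
    also have "\<dots> \<in> sumset ((\<lambda>a. d - a) ` A) (Suc n)"
      using uv(2) v(2) by (intro sumset_Suc_I) auto
    finally show ?case
      using u v(1) uv(1) by simp
  qed simp
  then show "x \<le> n * d" "n * d - x \<in> sumset ((\<lambda>a. d - a) ` A) n"
    by simp_all
qed

lemma reflect_image_twice:
  assumes "A \<subseteq> {..(d::nat)}"
  shows "(\<lambda>a. d - a) ` (\<lambda>a. d - a) ` A = A"
proof -
  have "(\<lambda>a. d - a) ` (\<lambda>a. d - a) ` A = (\<lambda>a. a) ` A"
    unfolding image_image by (rule image_cong) (use assms in auto)
  then show ?thesis
    by simp
qed

section \<open>Descent for sumsets\<close>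

definition descending :: "nat set \<Rightarrow> nat \<Rightarrow> bool" where
  "descending A d \<longleftrightarrow>
     (\<forall>n p. p \<in> sumset A (Suc n) \<longrightarrow> p + d \<in> sumset A (Suc n) \<longrightarrow> p \<in> sumset A n)"

text \<open>One step raises only the order of the sumset, the other also adds \<open>d\<close>; they
  are the traces of adding \<open>(0, d)\<close> and \<open>(d, 0)\<close>.\<close>

lemma descending_iterate:
  assumes "descending A d" "0 \<in> A" "d \<in> A" "p \<in> sumset A (n + m)" "p + l * d \<in> sumset A (n + l)"
  shows "p \<in> sumset A n"
proof -
  let ?s = "\<lambda>(p, n). (p, Suc n)" and ?t = "\<lambda>(p, n). (p + d, Suc n)"
  let ?P = "\<lambda>(p, n). p \<in> sumset A n"
  have s: "(?s ^^ m) (p, n) = (p, n + m)" for m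
    by (induction m) simp_all
  have t: "(?t ^^ l) (p, n) = (p + l * d, n + l)" for l
    by (induction l) (simp_all add: algebra_simps)
  have "?P (p, n)"
  proof (rule both_directions_iterate[of ?s ?t ?P m _ l])
    show "?P (?s x)" if "?P x" for x
      using that sumset_mono[OF assms(2), of "snd x" "Suc (snd x)"] by (simp add: case_prod_beta)
    show "?P (?t x)" if "?P x" for x
      using that sumset_Suc_I[OF assms(3), of "fst x" "snd x"] by (simp add: case_prod_beta add.commute)
    show "?P x" if "?P (?s x)" "?P (?t x)" for x
      using that assms(1) unfolding descending_def by (cases x) simp
    show "?P ((?s ^^ m) (p, n))"
      unfolding s using assms(4) by simp
    show "?P ((?t ^^ l) (p, n))"
      unfolding t using assms(5) by simp
  qed (simp add: case_prod_beta)
  then show ?thesis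
    by simp
qed

text \<open>Reflection in \<open>Suc n * d\<close> sends \<open>p\<close> and \<open>p + d\<close>
  to \<open>n * d - p + d\<close> and \<open>n * d - p\<close>, so the two premises are
  exchanged.\<close>

lemma descending_reflect:
  assumes "A \<subseteq> {..d}" "descending A d"
  shows "descending ((\<lambda>a. d - a) ` A) d"
  unfolding descending_def
proof (intro allI impI)
  let ?B = "(\<lambda>a. d - a) ` A"
  have B: "?B \<subseteq> {..d}"
    by auto
  fix n p assume p: "p \<in> sumset ?B (Suc n)" "p + d \<in> sumset ?B (Suc n)"
  have le: "p \<le> n * d"
    using sumset_reflect(1)[OF B p(2)] by simp
  have "Suc n * d - p \<in> sumset A (Suc n)" "Suc n * d - (p + d) \<in> sumset A (Suc n)"
    using sumset_reflect(2)[OF B p(1)] sumset_reflect(2)[OF B p(2)] unfolding reflect_image_twice[OF assms(1)] .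
  then have "n * d - p \<in> sumset A (Suc n)" "n * d - p + d \<in> sumset A (Suc n)"
    using le by (simp_all add: add.commute)
  then have "n * d - p \<in> sumset A n"
    using assms(2) unfolding descending_def by blast
  from sumset_reflect(2)[OF assms(1) this] show "p \<in> sumset ?B n"
    using le by simp
qed

text \<open>Adding \<open>a \<le> \<epsilon>\<close> moves the right end of the covered interval by
  \<open>a\<close> without a gap.\<close>

lemma interval_upward:
  assumes "0 \<in> A" "a \<in> A" "a \<le> \<epsilon>" "\<forall>j<\<epsilon>. i + j \<in> A" "i \<le> x" "x < i + m * a + \<epsilon>"
  shows "x \<in> sumset A (Suc m)"
  using assms(5,6)
proof (induction m arbitrary: x)
  case 0
  then show ?case
    using assms(4) by (auto simp: le_iff_add)
next
  case (Suc m)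
  show ?case
  proof (cases "x < i + m * a + \<epsilon>")
    case True
    show ?thesis
      by (rule sumset_mono[OF assms(1) _ Suc.IH[OF Suc.prems(1) True]]) simp
  next
    case False
    then have x: "i \<le> x - a" "x - a < i + m * a + \<epsilon>" "x = a + (x - a)"
      using Suc.prems assms(3) by auto
    show ?thesis
      by (subst x(3)) (rule sumset_Suc_I[OF assms(2) Suc.IH[OF x(1,2)]])
  qed
qed

text \<open>Measured relative to \<open>m * d\<close>, adding \<open>d\<close> keeps the interval
  fixed and adding \<open>d - c\<close> moves it left by \<open>c \<le> \<epsilon>\<close>, so its
  left end recedes without a gap.\<close>

lemma interval_downward:
  assumes "d \<in> A" "d - c \<in> A" "c \<le> d" "c \<le> \<epsilon>" "\<forall>j<\<epsilon>. i + j \<in> A" "i \<le> x + m * c" "x < i + \<epsilon>"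
  shows "x + m * d \<in> sumset A (Suc m)"
  using assms(6,7)
proof (induction m arbitrary: x)
  case 0
  then show ?case
    using assms(5) by (auto simp: le_iff_add)
next
  case (Suc m)
  show ?case
  proof (cases "i \<le> x + m * c")
    case True
    then have "d + (x + m * d) \<in> sumset A (Suc (Suc m))"
      using Suc by (intro sumset_Suc_I[OF assms(1)]) auto
    then show ?thesis
      by (simp add: ac_simps)
  next
    case False
    then have "(d - c) + (x + c + m * d) \<in> sumset A (Suc (Suc m))"
      using Suc.prems assms(4) by (intro sumset_Suc_I[OF assms(2)] Suc.IH) auto
    then show ?thesis
      using assms(3) by (simp add: ac_simps)
  qed
qed

text \<open>The spread block gives membership of the translates by multiples of \<open>d\<close>.
  Iterated descent then brings membership down to \<open>A\<close> itself, contradicting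
  \<open>x \<notin> A\<close>, or to \<open>sumset A 2\<close>.\<close>

lemma descending_imp_left_condition:
  assumes "descending A d" "A \<subseteq> {..d}" "0 \<in> A" "d \<in> A" "a \<in> A" "1 \<le> a" "a \<le> \<epsilon>"
    and "d - c \<in> A" "1 \<le> c" "c \<le> d" "c \<le> \<epsilon>" "\<forall>j<\<epsilon>. i + j \<in> A" "i \<le> d"
    and x: "x < i" "x \<notin> A"
  shows "x \<notin> monoid_span A" "x + d \<in> sumset A 2"
proof -
  \<comment> \<open>As \<open>c \<ge> 1\<close>, \<open>i\<close> steps to the left suffice to reach
    zero.\<close>
  have down: "x + m * d \<in> sumset A (Suc m)" if "i \<le> m" for m
  proof -
    have "m \<le> m * c"
      using assms(9) by simp
    then have "i \<le> x + m * c"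
      using that by linarith
    then show ?thesis
      using x(1) by (intro interval_downward[OF assms(4,8,10,11,12)]) auto
  qed
  show "x \<notin> monoid_span A"
  proof
    assume "x \<in> monoid_span A"
    then obtain n where "x \<in> sumset A n"
      using monoid_span_eq_sumset by blast
    then have "x \<in> sumset A (1 + n)"
      by (rule sumset_mono[OF assms(3), rotated]) simp
    moreover have "x + i * d \<in> sumset A (1 + i)"
      using down[of i] by simp
    ultimately have "x \<in> sumset A 1"
      by (rule descending_iterate[OF assms(1,3,4)])
    then show False
      using x(2) by simp
  qed
  \<comment> \<open>As \<open>a \<ge> 1\<close>, \<open>x + d\<close> steps to the right certainly
    reach \<open>x + d\<close>.\<close>
  have "x + d \<le> (x + d) * a"
    using assms(6) by simp
  then have "x + d < i + (x + d) * a + \<epsilon>"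
    using assms(6,7) by linarith
  then have "x + d \<in> sumset A (Suc (x + d))"
    using assms(13) by (intro interval_upward[OF assms(3,5,7,12)]) auto
  then have "x + d \<in> sumset A (2 + (x + d))"
    by (rule sumset_mono[OF assms(3), rotated]) simp
  moreover have "x + d + i * d \<in> sumset A (2 + i)"
    using down[of "Suc i"] by (simp add: ac_simps)
  ultimately show "x + d \<in> sumset A 2"
    by (rule descending_iterate[OF assms(1,3,4)])
qed

text \<open>Left of the block and right of its last translate, the exclusions from the two monoids
  force membership in \<open>A\<close>; in between, the memberships in \<open>sumset A 2\<close>
  fill the gaps between translates by \<open>d\<close>.\<close>

lemma conditions_imp_descending:
  assumes "A \<subseteq> {..d}" "0 \<in> A" "d \<in> A" "0 < d" "0 < \<epsilon>" "\<forall>j<\<epsilon>. i + j \<in> A"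
    and left: "\<And>x. x < i \<Longrightarrow> x \<notin> A \<Longrightarrow> x \<notin> monoid_span A \<and> x + d \<in> sumset A 2"
    and right: "\<And>x. i + \<epsilon> \<le> x \<Longrightarrow> x \<le> d \<Longrightarrow> x \<notin> A \<Longrightarrow>
      d - x \<notin> monoid_span ((\<lambda>a. d - a) ` A) \<and> x \<in> sumset A 2"
  shows "descending A d"
proof -
  have interval: "x \<in> A" if "i \<le> x" "x < i + \<epsilon>" for x
    using assms(6)[rule_format, of "x - i"] that by simp
  have two: "x \<in> sumset A 2" if "x \<in> A" for x
    using that sumset_mono[OF assms(2), of "Suc 0" 2] by simp
  have dA: "x \<in> sumset A (Suc n)" if "d \<le> x" "x - d \<in> sumset A n" for x n
    using sumset_Suc_I[OF assms(3) that(2)] that(1) by simp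
  have cover: "y \<in> sumset A (Suc m)" if "i \<le> y" "y < m * d + i + \<epsilon>" for y m
    using that
  proof (induction m arbitrary: y)
    case 0
    then show ?case
      using interval by simp
  next
    case (Suc m)
    note IH = Suc.IH
    show ?case
    proof (cases "y < m * d + i + \<epsilon>")
      case True
      show ?thesis
        by (rule sumset_mono[OF assms(2) _ Suc.IH[OF Suc.prems(1) True]]) simp
    next
      case far: False
      show ?thesis
      proof (cases m)
        case 0
        \<comment> \<open>The first gap: up to \<open>d\<close> it is filled by
          \<open>right\<close>, beyond \<open>d\<close> by \<open>left\<close> applied to
          \<open>y - d\<close>. Later gaps are translates of it.\<close>
        have "y \<in> sumset A 2"
        proof (cases "y \<le> d")
          case True
          then show ?thesis
            using right[of y] two[of y] far 0 by (cases "y \<in> A") simp_all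
        next
          case False
          show ?thesis
          proof (cases "y - d \<in> A")
            case True
            then show ?thesis
              using dA[of y "Suc 0"] False by (simp add: numeral_2_eq_2)
          next
            case nA: False
            have "y - d < i + \<epsilon>"
              using Suc.prems(2) 0 False by auto
            then have "y - d < i"
              using interval[of "y - d"] nA not_less by blast
            then show ?thesis
              using left[of "y - d"] nA False by simp
          qed
        qed
        then show ?thesis
          using 0 by (simp add: numeral_2_eq_2)
      next
        case (Suc l)
        then have y: "d \<le> y" "i \<le> y - d" "y - d < m * d + i + \<epsilon>"
          using far Suc.prems by auto
        show ?thesis
          by (rule dA[OF y(1) IH[OF y(2,3)]])
      qed
    qed
  qed
  show ?thesis
    unfolding descending_def
  proof (intro allI impI)
    fix n p assume p: "p \<in> sumset A (Suc n)" "p + d \<in> sumset A (Suc n)"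
    have le: "p \<le> n * d"
      using sumset_reflect(1)[OF assms(1) p(2)] by simp
    show "p \<in> sumset A n"
    proof (cases n)
      case 0
      then show ?thesis
        using le by simp
    next
      case (Suc m)
      show ?thesis
      proof (cases "p < i")
        case True
        then have "p \<in> A"
          using left p(1) monoid_span_eq_sumset by blast
        then show ?thesis
          using sumset_mono[OF assms(2), of "Suc 0" n] Suc by simp
      next
        case False
        show ?thesis
        proof (cases "p < m * d + i + \<epsilon>")
          case True
          then show ?thesis
            using cover False Suc by simp
        next
          case far: False
          \<comment> \<open>Here \<open>p - m * d\<close> lies between \<open>i + \<epsilon>\<close>
            and \<open>d\<close>, and reflecting \<open>p + d\<close> puts its complement into the
            reflected monoid; \<open>right\<close> leaves only
            \<open>p - m * d \<in> A\<close>.\<close>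
          have "Suc n * d - (p + d) \<in> monoid_span ((\<lambda>a. d - a) ` A)"
            using sumset_reflect(2)[OF assms(1) p(2)] monoid_span_eq_sumset by blast
          moreover have "Suc n * d - (p + d) = d - (p - m * d)"
            using far le Suc by simp
          ultimately have "p - m * d \<in> A"
            using right[of "p - m * d"] far le Suc by fastforce
          moreover have "m * d \<in> sumset A m"
            by (induction m) (use sumset_Suc_I[OF assms(3)] in auto)
          ultimately have "(p - m * d) + m * d \<in> sumset A (Suc m)"
            by (rule sumset_Suc_I)
          then show ?thesis
            using far Suc by simp
        qed
      qed
    qed
  qed
qed

text \<open>The right-hand condition is the left-hand one for the reflected set, where the bounds
  \<open>a\<close> and \<open>d - b\<close> on the end gaps change roles.\<close>

lemma descending_iff_conditions:
  assumes "A \<subseteq> {..d}" "0 \<in> A" "d \<in> A" "a \<in> A" "1 \<le> a" "a \<le> \<epsilon>" "b \<in> A" "b < d" "d - b \<le> \<epsilon>"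
    and "\<forall>j<\<epsilon>. i + j \<in> A" "i + \<epsilon> \<le> d + 1"
  shows "descending A d \<longleftrightarrow>
    (\<forall>x\<in>{0..<i} - A. x \<notin> monoid_span A \<and> x + d \<in> sumset A 2) \<and>
    (\<forall>x\<in>{i + \<epsilon>..d} - A. d - x \<notin> monoid_span ((\<lambda>a. d - a) ` A) \<and> x \<in> sumset A 2)"
    (is "_ \<longleftrightarrow> ?left \<and> ?right")
proof
  assume desc: "descending A d"
  have ad: "a \<le> d"
    using subsetD[OF assms(1,4)] by simp
  have ?left
  proof
    fix x assume x: "x \<in> {0..<i} - A"
    show "x \<notin> monoid_span A \<and> x + d \<in> sumset A 2"
    proof -
      have c: "d - (d - b) \<in> A" "1 \<le> d - b" "d - b \<le> d" "i \<le> d" "x < i" "x \<notin> A"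
        using assms(5-8,11) x by auto
      note left = descending_imp_left_condition[OF desc assms(1-6) c(1-3) assms(9,10) c(4-6)]
      show ?thesis
        using left by simp
    qed
  qed
  moreover have ?right
  proof
    let ?B = "(\<lambda>a. d - a) ` A"
    have B: "?B \<subseteq> {..d}"
      by auto
    fix x assume x: "x \<in> {i + \<epsilon>..d} - A"
    have nB: "d - x \<notin> ?B"
      using x assms(1) by (auto simp: subset_iff) (metis diff_diff_cancel)
    \<comment> \<open>The reflected block starts at the complement of its last element
      \<open>i + \<epsilon> - 1\<close>; its \<open>j\<close>-th element is the complement of the
      original one with index \<open>\<epsilon> - 1 - j\<close>.\<close>
    have int: "\<forall>j<\<epsilon>. (d + 1 - (i + \<epsilon>)) + j \<in> ?B"
    proof (intro allI impI)
      fix j assume "j < \<epsilon>"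
      then have "d + 1 - (i + \<epsilon>) + j = d - (i + (\<epsilon> - 1 - j))" "i + (\<epsilon> - 1 - j) \<in> A"
        using assms(10)[rule_format, of "\<epsilon> - 1 - j"] assms(11) by auto
      then show "d + 1 - (i + \<epsilon>) + j \<in> ?B"
        by blast
    qed
    have mem: "0 \<in> ?B" "d \<in> ?B" "d - b \<in> ?B" "d - a \<in> ?B"
      using assms(2,3,4,7) by (auto intro: image_eqI[of _ _ d] image_eqI[of _ _ 0])
    have "1 \<le> d - b" "d + 1 - (i + \<epsilon>) \<le> d" "d - x < d + 1 - (i + \<epsilon>)"
      using x assms(5,6,8,11) by auto
    note desc' = descending_imp_left_condition[OF descending_reflect[OF assms(1) desc] B mem(1-3) this(1)
      assms(9) mem(4) assms(5) ad assms(6) int this(2,3) nB]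
    have "d - x \<notin> monoid_span ?B" "d - x + d \<in> sumset ?B 2"
      using desc' by simp_all
    moreover from this(2) have "2 * d - (d - x + d) \<in> sumset A 2"
      using sumset_reflect(2)[OF B] unfolding reflect_image_twice[OF assms(1)] by blast
    ultimately show "d - x \<notin> monoid_span ?B \<and> x \<in> sumset A 2"
      using x by simp
  qed
  ultimately show "?left \<and> ?right" ..
next
  assume "?left \<and> ?right"
  then show "descending A d"
    using assms by (intro conditions_imp_descending[of A d \<epsilon> i]) auto
qed

text \<open>Every generator has coordinate sum \<open>d\<close>, so the total counts the generators
  used, while the first coordinate is their sum in \<open>A\<close>.\<close>

lemma monoid_span_degree:
  assumes "A \<subseteq> {..d}"
  shows "(p, q) \<in> monoid_span ((\<lambda>a. (a, d - a)) ` A) \<longleftrightarrow> (\<exists>n. p + q = n * d \<and> p \<in> sumset A n)"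
proof -
  have "\<exists>n. fst x + snd x = n * d \<and> fst x \<in> sumset A n"
    if "x \<in> monoid_span ((\<lambda>a. (a, d - a)) ` A)" for x
    using that
  proof induction
    case zero
    show ?case
      by (rule exI[of _ 0]) simp
  next
    case (gen x)
    then show ?case
      using assms by (intro exI[of _ "Suc 0"]) auto
  next
    case (add x y)
    then obtain m n where "fst x + snd x = m * d" "fst x \<in> sumset A m"
      "fst y + snd y = n * d" "fst y \<in> sumset A n"
      by blast
    then show ?case
      using sumset_add by (intro exI[of _ "m + n"]) (auto simp: algebra_simps)
  qed
  moreover have "(p, n * d - p) \<in> monoid_span ((\<lambda>a. (a, d - a)) ` A)" if "p \<in> sumset A n" for p n
    using that
  proof (induction n arbitrary: p)
    case 0
    then show ?case
      using monoid_span.zero[of "(\<lambda>a. (a, d - a)) ` A"] by (simp add: zero_prod_def)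
  next
    case (Suc n)
    then obtain u v where uv: "p = u + v" "u \<in> A" "v \<in> sumset A n"
      using sumset_Suc_E by blast
    then have "(p, Suc n * d - p) = (u, d - u) + (v, n * d - v)"
      using sumset_reflect(1)[OF assms uv(3)] assms by auto
    moreover have "(u, d - u) \<in> monoid_span ((\<lambda>a. (a, d - a)) ` A)"
      using uv(2) by (intro monoid_span.gen) auto
    ultimately show ?case
      using Suc.IH[OF uv(3)] monoid_span.add by metis
  qed
  ultimately show ?thesis
    by (metis add_diff_cancel_left' fst_conv snd_conv)
qed

text \<open>Adding \<open>(d, 0)\<close> or \<open>(0, d)\<close> raises the degree by one and
  changes the first coordinate by \<open>d\<close> or not at all; so descent in the monoid becomes
  descent of sumsets.\<close>

theorem cohen_macaulay_iff_descending:
  fixes A :: "nat set"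
  assumes "A \<subseteq> {..d}" "0 \<in> A" "d \<in> A" "0 < d"
  shows "cohen_macaulay (semigroup_ring (monoid_span ((\<lambda>a. (a, d - a)) ` A)) ::
    (nat \<times> nat \<Rightarrow>\<^sub>0 'k::field) ring) \<longleftrightarrow> descending A d"
    (is "cohen_macaulay (semigroup_ring (monoid_span ?G)) \<longleftrightarrow> _")
proof -
  have "finite A"
    using assms(1) finite_subset by blast
  then have fin: "finite ?G"
    by simp
  have "(d, d - d) \<in> monoid_span ?G" "(0, d - 0) \<in> monoid_span ?G"
    using assms(2,3) by (blast intro: monoid_span.gen)+
  then have e: "(d, 0) \<in> monoid_span ?G" "(0, d) \<in> monoid_span ?G"
    by simp_all
  have nz: "0 \<notin> ?G"
    using assms(4) by (auto simp: prod_eq_iff)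
  note mem = monoid_span_degree[OF assms(1)]
  show ?thesis
  proof
    assume CM: "cohen_macaulay (semigroup_ring (monoid_span ?G) :: (nat \<times> nat \<Rightarrow>\<^sub>0 'k) ring)"
    show "descending A d"
      unfolding descending_def
    proof (intro allI impI)
      fix n p assume p: "p \<in> sumset A (Suc n)" "p + d \<in> sumset A (Suc n)"
      have le: "p \<le> n * d"
        using sumset_reflect(1)[OF assms(1) p(2)] by simp
      have sums: "p + d + (n * d - p) = Suc n * d" "p + (n * d - p + d) = Suc n * d"
        using le by simp_all
      have "(p + d, n * d - p) \<in> monoid_span ?G" "(p, n * d - p + d) \<in> monoid_span ?G"
        using mem sums p by blast+
      then have "(p, n * d - p) + (d, 0) \<in> monoid_span ?G" "(p, n * d - p) + (0, d) \<in> monoid_span ?G"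
        by simp_all
      then have "(p, n * d - p) \<in> monoid_span ?G"
        by (rule descending_of_cohen_macaulay[OF fin nz assms(4) e CM])
      then obtain m where "p + (n * d - p) = m * d" "p \<in> sumset A m"
        unfolding mem by (elim exE conjE)
      then show "p \<in> sumset A n"
        using assms(4) le by simp
    qed
  next
    assume desc: "descending A d"
    show "cohen_macaulay (semigroup_ring (monoid_span ?G) :: (nat \<times> nat \<Rightarrow>\<^sub>0 'k) ring)"
    proof (rule cohen_macaulay_of_descending[OF fin assms(4) e])
      fix x assume x: "x + (d, 0) \<in> monoid_span ?G" "x + (0, d) \<in> monoid_span ?G"
      obtain p q where pq: "x = (p, q)"
        by (cases x)
      obtain n where n: "p + d + q = n * d" "p + d \<in> sumset A n"
        using x(1) mem[of "p + d" q] by (auto simp: pq)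
      obtain n' where n': "p + (q + d) = n' * d" "p \<in> sumset A n'"
        using x(2) mem[of p "q + d"] by (auto simp: pq)
      have "n * d = n' * d"
        using n(1) n'(1) by (simp add: ac_simps)
      then have "n' = n"
        using assms(4) by simp
      obtain m where m: "n = Suc m"
        using n(1) assms(4) by (cases n) auto
      then have "p \<in> sumset A m"
        using desc n(2) n'(2) \<open>n' = n\<close> unfolding descending_def by blast
      moreover have "p + q = m * d"
        using n(1) m by simp
      ultimately show "x \<in> monoid_span ?G"
        unfolding pq mem by blast
    qed
  qed
qed

theorem proposition3p7:
  fixes k d i \<epsilon> :: nat and a :: "nat \<Rightarrow> nat" and A\<^sub>1 A\<^sub>2 twoA\<^sub>1 :: "nat set"
    and S :: "(nat \<times> nat) set"
  assumes "k \<ge> 3"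
    and "a 0 = 0" and "strict_mono_on {0..k} a" and "a k = d"
    and "Gcd (a ` {1..k}) = 1"
    and "A\<^sub>1 = a ` {0..k}"
    and "A\<^sub>2 = {d - a j | j. j \<in> {0..k}}"
    and "twoA\<^sub>1 = {x + y | x y. x \<in> A\<^sub>1 \<and> y \<in> A\<^sub>1}"
    and "S = monoid_span {(a j, d - a j) | j. j \<in> {0..k}}"
    and "\<epsilon> = max (a 1) (d - a (k - 1))"
    and "i \<le> d - \<epsilon> + 1"
    and "\<forall>j<\<epsilon>. i + j \<in> A\<^sub>1"
  shows "cohen_macaulay (semigroup_ring S :: ((nat \<times> nat) \<Rightarrow>\<^sub>0 'k::field) ring) \<longleftrightarrow>
    (\<forall>x\<in>{0..<i} - A\<^sub>1. x \<notin> monoid_span A\<^sub>1 \<and> x + d \<in> twoA\<^sub>1) \<and>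
    (\<forall>x\<in>{i + \<epsilon>..d} - A\<^sub>1. d - x \<notin> monoid_span A\<^sub>2 \<and> x \<in> twoA\<^sub>1)"
proof -
  have d: "a j < d" if "j < k" for j
    using strict_mono_onD[OF assms(3), of j k] that assms(4) by simp
  have sub: "A\<^sub>1 \<subseteq> {..d}"
    unfolding assms(6) using d assms(4) by (auto simp: le_less)
  have "a 0 < a 1"
    using strict_mono_onD[OF assms(3), of 0 1] assms(1) by simp
  then have a1: "1 \<le> a 1"
    by simp
  have mem: "a j \<in> A\<^sub>1" if "j \<le> k" for j
    unfolding assms(6) using that by simp
  have zd: "0 \<in> A\<^sub>1" "d \<in> A\<^sub>1" "a 1 \<in> A\<^sub>1" "a (k - 1) \<in> A\<^sub>1"
    using mem[of 0] mem[of k] mem[of 1] mem[of "k - 1"] assms(1,2,4) by simp_all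
  have bd: "a (k - 1) < d" "0 < d" "a 1 < d"
    using d[of "k - 1"] d[of 1] assms(1) by auto
  have "\<epsilon> \<le> d"
    using assms(10) bd by simp
  \<comment> \<open>With \<open>\<epsilon> \<le> d\<close> the subtraction in the bound on
    \<open>i\<close> is not truncated, so the block ends at \<open>d\<close> or earlier.\<close>
  then have eps: "i + \<epsilon> \<le> d + 1" "a 1 \<le> \<epsilon>" "d - a (k - 1) \<le> \<epsilon>"
    using assms(11) by (linarith, simp_all add: assms(10))
  have A2: "A\<^sub>2 = (\<lambda>a. d - a) ` A\<^sub>1"
    unfolding assms(6,7) by auto
  have "{(a j, d - a j) |j. j \<in> {0..k}} = (\<lambda>a. (a, d - a)) ` A\<^sub>1"
    unfolding assms(6) by auto
  then have S: "S = monoid_span ((\<lambda>a. (a, d - a)) ` A\<^sub>1)"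
    using assms(9) by simp
  have two: "twoA\<^sub>1 = sumset A\<^sub>1 2"
    unfolding assms(8) sumset_2 ..
  show ?thesis
    unfolding S A2 two cohen_macaulay_iff_descending[OF sub zd(1,2) bd(2)]
    by (rule descending_iff_conditions[OF sub zd(1-3) a1 eps(2) zd(4) bd(1) eps(3) assms(12) eps(1)])
qed

end
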